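(* Let $k\le n/2$ and $\delta>0$. Define $$B_*=\Bigl\{\mathcal X\in\mathrm{Gr}(n,k):\ \sin^2(\theta_k(\mathcal X,\mathcal V_\alpha))\le\frac{\delta}{\lambda_1+\lambda_k}\Bigr\}.$$ Then $f$ is geodesically convex on $B_*$.
   Context: Let $1\le k\le n-1$ and let $A\in\mathbb R^{n\times n}$ be symmetric positive semidefinite with eigenvalues $\lambda_1\ge\cdots\ge\lambda_n$ (with multiplicity) and orthonormal eigenvectors $v_1,\dots,v_n$, $Av_i=\lambda_iv_i$. Put $\delta=\lambda_k-\lambda_{k+1}$ and $\mathcal V_\alpha=\mathrm{span}(v_1,\dots,v_k)$. $\mathrm{Gr}(n,k)$ is the Grassmann manifold of $k$-dimensional subspaces of $\mathbb R^n$; a subspace $\mathcal X=\mathrm{span}(X)$ is always represented by $X\in\mathbb R^{n\times k}$ with $X^TX=I_k$. Tangent vectors at $\mathcal X$ (for a given representative $X$) are the $G\in\mathbb R^{n\times k}$ with $X^TG=0$; the Riemannian metric is $\langle G_1,G_2\rangle=\mathrm{Tr}(G_1^TG_2)$. Geodesics through $\mathcal X$ are the curves $t\mapsto\mathrm{Exp}_{\mathcal X}(tG)$, $\mathrm{Exp}_{\mathcal X}(tG)=\mathrm{span}(XV\cos(t\Sigma)+U\sin(t\Sigma))$, where $G=U\Sigma V^T$ is a compact SVD with $\Sigma,V\in\mathbb R^{k\times k}$. $\theta_k(\mathcal X,\mathcal Y)\in[0,\pi/2]$ denotes the largest principal angle between $\mathcal X=\mathrm{span}(X)$ and $\mathcal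 Y=\mathrm{span}(Y)$, i.e. $\cos\theta_k$ is the smallest singular value of $Y^TX$. The objective is $f:\mathrm{Gr}(n,k)\to\mathbb R$, $f(\mathcal X)=-\mathrm{Tr}(X^TAX)$. A set $S\subseteq\mathrm{Gr}(n,k)$ is geodesically convex if any two of its points are joined by a geodesic segment contained in $S$; $f$ is geodesically convex on $S$ if $S$ is geodesically convex and $f\circ c:[0,1]\to\mathbb R$ is convex for every geodesic segment $c:[0,1]\to\mathrm{Gr}(n,k)$ with image in $S$. *)

theory Defs
  imports "HOL-Analysis.Analysis"
begin

text \<open>
  The ambient space is \<open>real^'n\<close> and the dimension of the subspaces is \<open>CARD('k)\<close>, so that an
  n-by-k matrix has type \<open>real^'k^'n\<close>. Points of the Grassmann manifold are the subspaces
  themselves; since the type of a subspace does not mention \<open>'k\<close>, it is passed as \<open>TYPE('k)\<close>.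
\<close>

definition grassmannian :: "'k::finite itself \<Rightarrow> (real^'n) set set" where
  "grassmannian _ = {S. subspace S \<and> dim S = CARD('k)}"

definition frame :: "real^'k^'n \<Rightarrow> bool" where
  "frame X \<longleftrightarrow> transpose X ** X = mat 1"

text \<open>
  An arbitrarily chosen orthonormal representative of a subspace. The lemmas
  \<open>objective_span_columns\<close> and \<open>largest_principal_angle_span_columns\<close> below show that the
  functions defined through it do not depend on the choice.
\<close>

definition frame_of :: "(real^'n) set \<Rightarrow> real^'k^'n" where
  "frame_of S = (SOME X. frame X \<and> span (columns X) = S)"

definition objective :: "'k::finite itself \<Rightarrow> real^'n^'n \<Rightarrow> (real^'n) set \<Rightarrow> real" where
  "objective _ A S = (let X = (frame_of S :: real^'k^'n) in - trace (transpose X ** A ** X))"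

definition singular_values :: "real^'k^'k \<Rightarrow> real set" where
  "singular_values M =
     {\<sigma>. 0 \<le> \<sigma> \<and> (\<exists>x. x \<noteq> 0 \<and> (transpose M ** M) *v x = \<sigma>\<^sup>2 *\<^sub>R x)}"

definition largest_principal_angle ::
    "'k::finite itself \<Rightarrow> (real^'n) set \<Rightarrow> (real^'n) set \<Rightarrow> real" where
  "largest_principal_angle _ S T =
     (let X = (frame_of S :: real^'k^'n); Y = (frame_of T :: real^'k^'n)
      in arccos (Min (singular_values (transpose Y ** X))))"

definition diag_mat :: "real^'k \<Rightarrow> real^'k^'k" where
  "diag_mat d = (\<chi> i j. if i = j then d $ i else 0)"

text \<open>
  The vector \<open>\<sigma>\<close> is the diagonal of the k-by-k factor; it may contain zeros. No ordering of the
  singular values is imposed, as permuting them does not affect the geodesic below.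
\<close>

definition compact_svd ::
    "real^'k^'n \<Rightarrow> real^'k^'n \<Rightarrow> real^'k \<Rightarrow> real^'k^'k \<Rightarrow> bool" where
  "compact_svd G U \<sigma> V \<longleftrightarrow>
     frame U \<and> orthogonal_matrix V \<and> (\<forall>i. 0 \<le> \<sigma> $ i) \<and>
     G = U ** diag_mat \<sigma> ** transpose V"

definition geodesic_segment :: "'k::finite itself \<Rightarrow> (real \<Rightarrow> (real^'n) set) \<Rightarrow> bool" where
  "geodesic_segment _ c \<longleftrightarrow>
     (\<exists>(X :: real^'k^'n) G U \<sigma> V.
        frame X \<and> transpose X ** G = 0 \<and> compact_svd G U \<sigma> V \<and>
        (\<forall>t\<in>{0..1}. c t =
           span (columns (X ** V ** diag_mat (\<chi> i. cos (t * \<sigma> $ i)) +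
                          U ** diag_mat (\<chi> i. sin (t * \<sigma> $ i))))))"

definition geodesically_convex :: "'k::finite itself \<Rightarrow> (real^'n) set set \<Rightarrow> bool" where
  "geodesically_convex K S \<longleftrightarrow>
     S \<subseteq> grassmannian K \<and>
     (\<forall>P\<in>S. \<forall>Q\<in>S. \<exists>c. geodesic_segment K c \<and> c 0 = P \<and> c 1 = Q \<and> c ` {0..1} \<subseteq> S)"

definition geodesically_convex_on ::
    "'k::finite itself \<Rightarrow> (real^'n) set set \<Rightarrow> ((real^'n) set \<Rightarrow> real) \<Rightarrow> bool" where
  "geodesically_convex_on K S f \<longleftrightarrow>
     geodesically_convex K S \<and>
     (\<forall>c. geodesic_segment K c \<and> c ` {0..1} \<subseteq> S \<longrightarrow> convex_on {0..1} (f \<circ> c))"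


lemma span_columns_eq_range:
  fixes X :: "real^'k^'n"
  shows "span (columns X) = range ((*v) X)"
proof
  show "range ((*v) X) \<subseteq> span (columns X)"
  proof clarify
    fix w
    have "column i X \<in> span (columns X)" for i
      by (intro span_base) (auto simp: columns_def)
    then show "X *v w \<in> span (columns X)"
      unfolding matrix_mult_sum scalar_mult_eq_scaleR by (intro span_sum span_scale)
  qed
  have "columns X \<subseteq> range ((*v) X)"
    by (auto simp: columns_def simp flip: matrix_vector_mult_basis)
  moreover have "subspace (range ((*v) X))"
    by (intro linear_subspace_image) auto
  ultimately show "span (columns X) \<subseteq> range ((*v) X)"
    by (rule span_minimal)
qed

lemma frame_change:
  fixes X Y :: "real^'k^'n"
  assumes "frame X" "frame Y" "span (columns X) = span (columns Y)"
  obtains Q where "orthogonal_matrix Q" "Y = X ** Q"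
proof -
  have "\<forall>j. \<exists>w. column j Y = X *v w"
  proof
    fix j
    have "column j Y \<in> span (columns Y)"
      by (intro span_base) (auto simp: columns_def)
    then show "\<exists>w. column j Y = X *v w"
      using assms(3) span_columns_eq_range[of X] by auto
  qed
  then obtain w where w: "\<And>j. column j Y = X *v w j" by metis
  define Q :: "real^'k^'k" where "Q = (\<chi> i j. w j $ i)"
  have eq: "Y = X ** Q"
    using w by (simp add: vec_eq_iff column_def matrix_vector_mult_def
        matrix_matrix_mult_def Q_def)
  have "transpose Q ** Q = transpose Q ** (transpose X ** X) ** Q"
    using assms(1) by (simp add: frame_def)
  also have "\<dots> = transpose Y ** Y"
    by (simp add: eq matrix_transpose_mul matrix_mul_assoc)
  also have "\<dots> = mat 1"
    using assms(2) by (simp add: frame_def)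
  finally have "orthogonal_matrix Q"
    by (simp add: orthogonal_matrix)
  then show ?thesis using eq that by blast
qed

lemma frame_of_span_columns:
  fixes X :: "real^'k^'n"
  assumes "frame X"
  shows "frame (frame_of (span (columns X)) :: real^'k^'n)"
    and "span (columns (frame_of (span (columns X)) :: real^'k^'n)) = span (columns X)"
proof -
  have "\<exists>Y :: real^'k^'n. frame Y \<and> span (columns Y) = span (columns X)"
    using assms by blast
  from someI_ex[OF this]
  show "frame (frame_of (span (columns X)) :: real^'k^'n)"
    and "span (columns (frame_of (span (columns X)) :: real^'k^'n)) = span (columns X)"
    by (simp_all add: frame_of_def)
qed

lemma grassmannian_eq_frames:
  "(grassmannian TYPE('k::finite) :: (real^'n) set set) =
     {span (columns X) | X :: real^'k^'n. frame X}"
proof (intro equalityI subsetI)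
  fix S :: "(real^'n) set"
  assume "S \<in> grassmannian TYPE('k)"
  then have S: "subspace S" "dim S = CARD('k)"
    by (auto simp: grassmannian_def)
  obtain B where B: "B \<subseteq> S" "pairwise orthogonal B" "\<And>x. x \<in> B \<Longrightarrow> norm x = 1"
      "independent B" "card B = dim S" "span B = S"
    using orthonormal_basis_subspace[OF S(1)] by metis
  have "finite B"
    using B(4) by (rule independent_imp_finite)
  then obtain g where g: "bij_betw g (UNIV :: 'k set) B"
    using S(2) B(5) finite_same_card_bij[of "UNIV :: 'k set" B] by auto
  define X :: "real^'k^'n" where "X = (\<chi> i j. g j $ i)"
  have col: "column j X = g j" for j
    by (simp add: X_def column_def vec_eq_iff)
  have gB: "g j \<in> B" for j
    using g by (auto simp: bij_betw_def)
  have "frame X"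
    unfolding frame_def matrix_mult_transpose_dot_column col mat_def
  proof (simp add: vec_eq_iff, intro allI conjI impI)
    fix i show "g i \<bullet> g i = 1"
      using B(3)[OF gB] by (simp add: norm_eq_1)
  next
    fix i j :: 'k assume "i \<noteq> j"
    then have "g i \<noteq> g j"
      using g by (auto simp: bij_betw_def inj_on_def)
    then show "g i \<bullet> g j = 0"
      using B(2) gB by (auto simp: pairwise_def orthogonal_def)
  qed
  moreover have "columns X = B"
    using g by (auto simp: columns_def col bij_betw_def)
  ultimately show "S \<in> {span (columns X) | X :: real^'k^'n. frame X}"
    using B(6) by blast
next
  fix S :: "(real^'n) set"
  assume "S \<in> {span (columns X) | X :: real^'k^'n. frame X}"
  then obtain X :: "real^'k^'n" where X: "frame X" "S = span (columns X)"
    by blast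
  have "inj ((*v) X)"
    using X(1) by (metis frame_def matrix_left_invertible_injective)
  then have "dim (range ((*v) X)) = dim (UNIV :: (real^'k) set)"
    by (intro dim_image_eq) auto
  then show "S \<in> grassmannian TYPE('k)"
    by (simp add: grassmannian_def X(2) span_columns_eq_range linear_subspace_image
        del: dim_span)
qed

lemma objective_span_columns:
  fixes X :: "real^'k^'n"
  assumes "frame X"
  shows "objective TYPE('k) A (span (columns X)) = - trace (transpose X ** A ** X)"
proof -
  obtain Q where Q: "orthogonal_matrix Q"
      "(frame_of (span (columns X)) :: real^'k^'n) = X ** Q"
    using frame_change[OF assms frame_of_span_columns(1)[OF assms]]
      frame_of_span_columns(2)[OF assms] by metis
  have "trace (transpose (X ** Q) ** A ** (X ** Q)) =
      trace (transpose Q ** (transpose X ** A ** X ** Q))"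
    by (simp add: matrix_transpose_mul matrix_mul_assoc)
  also have "\<dots> = trace (transpose X ** A ** X ** (Q ** transpose Q))"
    by (subst trace_mul_sym) (simp add: matrix_mul_assoc)
  also have "\<dots> = trace (transpose X ** A ** X)"
    using Q(1) by (simp add: orthogonal_matrix_def)
  finally show ?thesis
    by (simp add: objective_def Q(2))
qed

lemma singular_values_mult_orthogonal:
  fixes M P Q :: "real^'k^'k"
  assumes P: "orthogonal_matrix P" and Q: "orthogonal_matrix Q"
  shows "singular_values (transpose P ** M ** Q) = singular_values M"
proof -
  have sub: "singular_values (transpose P ** M ** Q) \<subseteq> singular_values M"
    if P: "orthogonal_matrix P" and Q: "orthogonal_matrix Q" for P Q M :: "real^'k^'k"
  proof
    fix s assume "s \<in> singular_values (transpose P ** M ** Q)"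
    then obtain x where s: "0 \<le> s" and x: "x \<noteq> 0" and
      e: "(transpose (transpose P ** M ** Q) ** (transpose P ** M ** Q)) *v x = s\<^sup>2 *\<^sub>R x"
      by (auto simp: singular_values_def)
    have "transpose (transpose P ** M ** Q) ** (transpose P ** M ** Q) =
        transpose Q ** transpose M ** (P ** transpose P) ** M ** Q"
      by (simp only: matrix_transpose_mul matrix_mul_assoc transpose_transpose)
    also have "\<dots> = transpose Q ** (transpose M ** M ** Q)"
      using P by (simp add: orthogonal_matrix_def matrix_mul_assoc)
    finally have "(Q ** transpose Q) *v ((transpose M ** M) *v (Q *v x)) = Q *v (s\<^sup>2 *\<^sub>R x)"
      using e by (simp add: matrix_vector_mul_assoc matrix_mul_assoc flip: e)
    then have "(transpose M ** M) *v (Q *v x) = s\<^sup>2 *\<^sub>R (Q *v x)"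
      using Q by (simp add: orthogonal_matrix_def matrix_vector_mult_scaleR)
    moreover have "Q *v x \<noteq> 0"
    proof
      assume "Q *v x = 0"
      then have "transpose Q *v (Q *v x) = 0" by simp
      with x Q show False
        by (simp add: matrix_vector_mul_assoc orthogonal_matrix_def)
    qed
    ultimately show "s \<in> singular_values M"
      using s by (auto simp: singular_values_def)
  qed
  have "M = P ** transpose P ** M ** (Q ** transpose Q)"
    using P Q by (simp add: orthogonal_matrix_def)
  also have "\<dots> = transpose (transpose P) ** (transpose P ** M ** Q) ** transpose Q"
    by (simp add: matrix_mul_assoc)
  finally have "singular_values M \<subseteq> singular_values (transpose P ** M ** Q)"
    using sub[of "transpose P" "transpose Q" "transpose P ** M ** Q"] P Q by simp
  with sub[OF P Q] show ?thesis by blast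
qed

lemma largest_principal_angle_span_columns:
  fixes X Y :: "real^'k^'n"
  assumes "frame X" "frame Y"
  shows "largest_principal_angle TYPE('k) (span (columns X)) (span (columns Y)) =
    arccos (Min (singular_values (transpose Y ** X)))"
proof -
  obtain Q where Q: "orthogonal_matrix Q"
      "(frame_of (span (columns X)) :: real^'k^'n) = X ** Q"
    using frame_change[OF assms(1) frame_of_span_columns(1)[OF assms(1)]]
      frame_of_span_columns(2)[OF assms(1)] by metis
  obtain P where P: "orthogonal_matrix P"
      "(frame_of (span (columns Y)) :: real^'k^'n) = Y ** P"
    using frame_change[OF assms(2) frame_of_span_columns(1)[OF assms(2)]]
      frame_of_span_columns(2)[OF assms(2)] by metis
  have "transpose (Y ** P) ** (X ** Q) = transpose P ** (transpose Y ** X) ** Q"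
    by (simp add: matrix_transpose_mul matrix_mul_assoc)
  then show ?thesis
    by (simp add: largest_principal_angle_def Q(2) P(2)
        singular_values_mult_orthogonal[OF P(1) Q(1)])
qed

end

theory Submission
  imports Defs
begin

text \<open>
  Let \<open>p\<close> be the orthogonal projector onto the dominant eigenspace and \<open>s = \<delta> / (\<lambda>\<^sub>1 + \<lambda>\<^sub>k)\<close>. A subspace
  \<open>S\<close> of the right dimension belongs to the ball iff \<open>\<bar>y - p y\<bar>\<^sup>2 \<le> s \<bar>y\<bar>\<^sup>2\<close> for all \<open>y\<close> in \<open>S\<close>
  (\<open>largest_principal_angle_le_iff_tilt_le\<close>), and \<open>s \<le> 1/2\<close> since \<open>A\<close> is positive semidefinite.

  Convexity of the objective. Let \<open>z\<^sub>i\<close> be the orthonormal vectors that span a geodesic at time \<open>t\<close>, and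
  \<open>w\<^sub>i\<close> their normalized velocities, orthogonal to the point of the geodesic wherever \<open>\<sigma>\<^sub>i \<noteq> 0\<close>. The second
  derivative of the objective is \<open>2 \<Sum>\<^sub>i \<sigma>\<^sub>i\<^sup>2 (z\<^sub>i \<bullet> A z\<^sub>i - w\<^sub>i \<bullet> A w\<^sub>i)\<close>. In the ball
  \<open>\<bar>p z\<^sub>i\<bar>\<^sup>2 \<ge> 1 - s\<close> and \<open>\<bar>p w\<^sub>i\<bar>\<^sup>2 \<le> s\<close>, so every difference is at least
  \<open>\<lambda>\<^sub>k (1 - s) - \<lambda>\<^sub>1 s - \<lambda>\<^sub>k\<^sub>+\<^sub>1 (1 - s) = s \<lambda>\<^sub>k\<^sub>+\<^sub>1 \<ge> 0\<close> (\<open>convex_on_geod_trace\<close>). This holds along any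
  geodesic segment in the ball, whether minimal or not.

  Convexity of the ball. Two of its points enclose principal angles of at most \<open>pi / 2\<close>, and the geodesic
  through principal vectors stays in the ball. As the ball is closed, it suffices that midpoints stay in it
  (\<open>tilt_le_midpoint\<close>). Write \<open>R\<^sub>S\<close> for the reflection in \<open>S\<close>. Membership of \<open>S\<close> implies
  \<open>R\<^sub>S y \<bullet> R y \<ge> (1 - 2 s) \<bar>y\<bar>\<^sup>2\<close> for all \<open>y\<close>, where \<open>R = 2 p - 1\<close>; this condition is linear in \<open>R\<^sub>S\<close>
  and survives averaging over the two ends. The average of the end reflections maps the midpoint to
  itself with eigenvalues in \<open>{0..1}\<close>, the cosines of the angles between the ends. Testing the averaged condition on
  the vector of the midpoint that is worst placed with respect to \<open>p\<close> shows that even this vector is close enough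
  to the dominant eigenspace.

  The argument degenerates only for \<open>s = 1/2\<close> and end points with a right principal angle, where minimal
  geodesics are not unique and some of them leave the ball. There \<open>R\<close> maps the orthogonal principal
  vectors of one end to those of the other (\<open>reflection_exchanges_right_angles\<close>), and the geodesic that
  joins each such vector to its image under \<open>R\<close> has the corresponding midpoint in the dominant eigenspace
  (\<open>connecting_geodesic\<close>).
\<close>

section \<open>Quadratic forms and eigenvectors\<close>

text \<open>
  On the line through \<open>x\<close> in direction \<open>y\<close> the form is a nonnegative polynomial with a zero at \<open>x\<close>,
  so its linear coefficient \<open>2 * (y \<bullet> f x)\<close> must vanish.
\<close>

lemma nonneg_form_null_vector:
  fixes f :: "'a::real_inner \<Rightarrow> 'a"
  assumes f: "linear f" and S: "subspace S"
    and sa: "\<And>x y. x \<in> S \<Longrightarrow> y \<in> S \<Longrightarrow> f x \<bullet> y = x \<bullet> f y"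
    and nonneg: "\<And>y. y \<in> S \<Longrightarrow> 0 \<le> y \<bullet> f y"
    and x: "x \<in> S" "x \<bullet> f x = 0" and y: "y \<in> S"
  shows "y \<bullet> f x = 0"
proof -
  define b c where "b = y \<bullet> f x" and "c = y \<bullet> f y"
  \<comment> \<open>The shift by 1 avoids the division by zero at \<open>c = 0\<close>; the form is still negative at this \<open>t\<close> unless \<open>b = 0\<close>.\<close>
  define t where "t = - b / (c + 1)"
  have c: "0 \<le> c" using nonneg[OF y] by (simp add: c_def)
  have "x + t *\<^sub>R y \<in> S" using S x y by (simp add: subspace_add subspace_scale)
  from nonneg[OF this] have "0 \<le> (x + t *\<^sub>R y) \<bullet> (f x + t *\<^sub>R f y)"
    by (simp add: linear_add[OF f] linear_scale[OF f])
  also have "\<dots> = 2 * t * b + t\<^sup>2 * c"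
    using sa[OF x(1) y] x(2)
    by (simp add: b_def c_def inner_add power2_eq_square algebra_simps inner_commute)
  also have "\<dots> = - b\<^sup>2 * (c + 2) / (c + 1)\<^sup>2"
    using c by (simp add: t_def power2_eq_square divide_simps) (simp add: algebra_simps)
  finally have "b\<^sup>2 * (c + 2) \<le> 0"
    using c by (simp add: divide_le_0_iff)
  then have "b\<^sup>2 \<le> 0" using c by (simp add: mult_le_0_iff)
  then show ?thesis by (simp add: b_def)
qed

text \<open>
  A minimizer \<open>x\<close> of the Rayleigh quotient is a null vector of the nonnegative form belonging to
  \<open>f - \<mu>\<close>; by \<open>nonneg_form_null_vector\<close> \<open>f x - \<mu> x\<close> is then orthogonal to all of \<open>S\<close>, itself included.
\<close>

lemma least_eigenvector:
  fixes f :: "'a::euclidean_space \<Rightarrow> 'a"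
  assumes f: "linear f" and S: "subspace S" "S \<noteq> {0}" "f ` S \<subseteq> S"
    and sa: "\<And>x y. x \<in> S \<Longrightarrow> y \<in> S \<Longrightarrow> f x \<bullet> y = x \<bullet> f y"
  obtains x \<mu> where "x \<in> S" "norm x = 1" "f x = \<mu> *\<^sub>R x"
    "\<And>y. y \<in> S \<Longrightarrow> \<mu> * (norm y)\<^sup>2 \<le> y \<bullet> f y"
proof -
  let ?K = "S \<inter> sphere 0 1"
  obtain s where s: "s \<in> S" "s \<noteq> 0"
    using S subspace_0 by blast
  have unit: "y /\<^sub>R norm y \<in> ?K" if "y \<in> S" "y \<noteq> 0" for y
    using that S(1) by (simp add: subspace_scale)
  have "compact ?K"
    using closed_subspace[OF S(1)] by (intro closed_Int_compact) auto
  moreover have "?K \<noteq> {}" using unit[OF s] by blast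
  moreover have "continuous_on ?K (\<lambda>y. y \<bullet> f y)"
    by (intro continuous_intros linear_continuous_on_compose[OF _ f])
  ultimately obtain x where x: "x \<in> ?K" and min: "\<And>y. y \<in> ?K \<Longrightarrow> x \<bullet> f x \<le> y \<bullet> f y"
    using continuous_attains_inf[of ?K "\<lambda>y. y \<bullet> f y"] by blast
  define \<mu> where "\<mu> = x \<bullet> f x"
  have le: "\<mu> * (norm y)\<^sup>2 \<le> y \<bullet> f y" if "y \<in> S" for y
  proof (cases "y = 0")
    case False
    have "\<mu> \<le> (y \<bullet> f y) / (norm y)\<^sup>2"
      using min[OF unit[OF that False]]
      by (simp add: \<mu>_def linear_scale[OF f] power2_eq_square divide_simps)
    then show ?thesis using False by (simp add: divide_simps)
  qed auto
  define g where "g y = f y - \<mu> *\<^sub>R y" for y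
  have g: "linear g" unfolding g_def
    by (intro linear_compose_sub f linear_compose_scale_right linear_ident)
  have xS: "x \<in> S" "norm x = 1" using x by auto
  have gS: "g x \<in> S" using S xS by (auto simp: g_def intro!: subspace_diff subspace_scale)
  have "g x \<bullet> g x = 0"
  proof (rule nonneg_form_null_vector[OF g S(1) _ _ xS(1) _ gS])
    show "g y \<bullet> z = y \<bullet> g z" if "y \<in> S" "z \<in> S" for y z
      using sa[OF that] by (simp add: g_def inner_diff)
    show "0 \<le> y \<bullet> g y" if "y \<in> S" for y
      using le[OF that] by (simp add: g_def inner_diff power2_norm_eq_inner)
    show "x \<bullet> g x = 0"
      using xS by (simp add: g_def inner_diff \<mu>_def norm_eq_1)
  qed
  then have "f x = \<mu> *\<^sub>R x" by (simp add: g_def)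
  with xS le that show ?thesis by blast
qed

text \<open>
  The spectral theorem on an invariant subspace: split off one eigenvector and recurse on its
  orthogonal complement in \<open>S\<close>, which is again invariant.
\<close>

lemma orthonormal_eigenbasis:
  fixes f :: "'a::euclidean_space \<Rightarrow> 'a"
  assumes f: "linear f" and S: "subspace S" "f ` S \<subseteq> S"
    and sa: "\<And>x y. x \<in> S \<Longrightarrow> y \<in> S \<Longrightarrow> f x \<bullet> y = x \<bullet> f y"
  shows "\<exists>B \<subseteq> S. finite B \<and> card B = dim S \<and> pairwise orthogonal B \<and>
    (\<forall>b\<in>B. norm b = 1 \<and> (\<exists>\<mu>. f b = \<mu> *\<^sub>R b))"
  using S sa
proof (induction "dim S" arbitrary: S)
  case 0
  then show ?case by (intro exI[of _ "{}"]) auto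
next
  case (Suc d)
  have "S \<noteq> {0}" using Suc.hyps(2) by auto
  then obtain x \<mu> where x: "x \<in> S" "norm x = 1" "f x = \<mu> *\<^sub>R x"
    using least_eigenvector[OF f Suc.prems(1) _ Suc.prems(2,3)] by metis
  define T where "T = {y \<in> S. orthogonal x y}"
  have T: "subspace T"
    using Suc.prems(1) by (auto simp: T_def subspace_def orthogonal_def inner_add)
  have "dim T + dim (span {x}) = dim S"
  proof -
    have "orthogonal x y \<longleftrightarrow> (\<forall>z\<in>span {x}. orthogonal z y)" for y
      by (auto simp: span_singleton orthogonal_def intro: bexI[of _ x] span_base)
    then have "T = {y \<in> S. \<forall>z\<in>span {x}. orthogonal z y}" by (auto simp: T_def)
    moreover have "span {x} \<subseteq> S" using x(1) Suc.prems(1) by (simp add: span_minimal)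
    ultimately show ?thesis
      using dim_subspace_orthogonal_to_vectors[of "span {x}" S] Suc.prems(1) by simp
  qed
  moreover have "dim (span {x}) = 1" using x(2) by (auto simp: dim_span dim_singleton)
  ultimately have d: "d = dim T" using Suc.hyps(2) by simp
  have fT: "f ` T \<subseteq> T"
  proof clarify
    fix y assume y: "y \<in> T"
    then have "x \<bullet> f y = f x \<bullet> y" using Suc.prems(3)[of x y] x by (simp add: T_def)
    also have "\<dots> = 0" using y x(3) by (simp add: T_def orthogonal_def)
    finally show "f y \<in> T" using y Suc.prems(2) by (auto simp: T_def orthogonal_def)
  qed
  obtain B where B: "B \<subseteq> T" "finite B" "card B = dim T" "pairwise orthogonal B"
    "\<forall>b\<in>B. norm b = 1 \<and> (\<exists>\<mu>. f b = \<mu> *\<^sub>R b)"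
    using Suc.hyps(1)[OF d T fT] Suc.prems(3) unfolding T_def by blast
  have "x \<notin> B" using B(1) x(2) by (auto simp: T_def orthogonal_def)
  moreover have "pairwise orthogonal (insert x B)"
    using B(1,4) by (auto simp: pairwise_insert T_def orthogonal_commute)
  ultimately show ?case
    using B x d Suc.hyps(2) by (intro exI[of _ "insert x B"]) (auto simp: T_def)
qed

section \<open>Orthonormal families and projectors\<close>

definition orthonormal :: "('i \<Rightarrow> 'a::real_inner) \<Rightarrow> bool" where
  "orthonormal x \<longleftrightarrow> (\<forall>i j. x i \<bullet> x j = (if i = j then 1 else 0))"

definition proj :: "('i::finite \<Rightarrow> 'a::real_inner) \<Rightarrow> 'a \<Rightarrow> 'a" where
  "proj x y = (\<Sum>i\<in>UNIV. (x i \<bullet> y) *\<^sub>R x i)"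

definition projector :: "('a::real_inner \<Rightarrow> 'a) \<Rightarrow> bool" where
  "projector p \<longleftrightarrow> linear p \<and> (\<forall>x y. p x \<bullet> y = x \<bullet> p y) \<and> (\<forall>x. p (p x) = p x)"

lemma orthonormalD: "orthonormal x \<Longrightarrow> x i \<bullet> x j = (if i = j then 1 else 0)"
  by (simp add: orthonormal_def)

lemma norm_orthonormal: "orthonormal x \<Longrightarrow> norm (x i) = 1"
  by (simp add: orthonormal_def norm_eq_1)

lemma inner_orthonormal_sum:
  fixes x :: "'i::finite \<Rightarrow> 'a::real_inner"
  assumes "orthonormal x"
  shows "x j \<bullet> (\<Sum>i\<in>UNIV. a i *\<^sub>R x i) = a j"
  by (simp add: inner_sum_right orthonormalD[OF assms] if_distrib sum.delta cong: if_cong)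

lemma inner_orthonormal_sums:
  fixes x :: "'i::finite \<Rightarrow> 'a::real_inner"
  assumes "orthonormal x"
  shows "(\<Sum>i\<in>UNIV. a i *\<^sub>R x i) \<bullet> (\<Sum>i\<in>UNIV. b i *\<^sub>R x i) = (\<Sum>i\<in>UNIV. a i * b i)"
  by (simp add: inner_sum_left inner_orthonormal_sum[OF assms])

lemma linear_proj: "linear (proj x)"
  unfolding proj_def
  by (intro linearI) (simp_all add: inner_add scaleR_left_distrib sum.distrib scaleR_sum_right)

lemma projector_proj:
  assumes "orthonormal x"
  shows "projector (proj x)"
proof -
  have "proj x y \<bullet> z = y \<bullet> proj x z" for y z
    by (simp add: proj_def inner_sum_left inner_sum_right inner_commute mult.commute)
  moreover have "proj x (proj x y) = proj x y" for y
    by (simp add: proj_def inner_orthonormal_sum[OF assms])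
  ultimately show ?thesis by (simp add: projector_def linear_proj)
qed

lemma span_range_finite_eq:
  fixes x :: "'i::finite \<Rightarrow> 'a::real_vector"
  shows "span (range x) = {\<Sum>i\<in>UNIV. a i *\<^sub>R x i | a. True}"
proof
  have gen: "range x \<subseteq> {\<Sum>i\<in>UNIV. a i *\<^sub>R x i | a. True}"
  proof clarify
    fix j
    have "x j = (\<Sum>i\<in>UNIV. (if i = j then 1 else 0) *\<^sub>R x i)"
      by (simp add: if_distrib[of "\<lambda>r. r *\<^sub>R _"] sum.delta cong: if_cong)
    then show "\<exists>a. x j = (\<Sum>i\<in>UNIV. a i *\<^sub>R x i) \<and> True" by (intro exI[of _ "\<lambda>i. if i = j then 1 else 0"] conjI TrueI)
  qed
  have sub: "subspace {\<Sum>i\<in>UNIV. a i *\<^sub>R x i | a. True}"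
    unfolding subspace_def
  proof (intro conjI ballI allI)
    show "0 \<in> {\<Sum>i\<in>UNIV. a i *\<^sub>R x i | a. True}" by (auto intro!: exI[of _ "\<lambda>_. 0"])
    fix y assume "y \<in> {\<Sum>i\<in>UNIV. a i *\<^sub>R x i | a. True}"
    then obtain a where a: "y = (\<Sum>i\<in>UNIV. a i *\<^sub>R x i)" by blast
    show "c *\<^sub>R y \<in> {\<Sum>i\<in>UNIV. a i *\<^sub>R x i | a. True}" for c
      by (auto simp: a scaleR_sum_right intro!: exI[of _ "\<lambda>i. c * a i"])
    fix z assume "z \<in> {\<Sum>i\<in>UNIV. a i *\<^sub>R x i | a. True}"
    then obtain b where b: "z = (\<Sum>i\<in>UNIV. b i *\<^sub>R x i)" by blast
    show "y + z \<in> {\<Sum>i\<in>UNIV. a i *\<^sub>R x i | a. True}"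
      by (auto simp: a b scaleR_left_distrib sum.distrib intro!: exI[of _ "\<lambda>i. a i + b i"])
  qed
  show "span (range x) \<subseteq> {\<Sum>i\<in>UNIV. a i *\<^sub>R x i | a. True}"
    by (rule span_minimal[OF gen sub])
  show "{\<Sum>i\<in>UNIV. a i *\<^sub>R x i | a. True} \<subseteq> span (range x)"
  proof clarify
    fix a :: "'i \<Rightarrow> real"
    show "(\<Sum>i\<in>UNIV. a i *\<^sub>R x i) \<in> span (range x)"
      by (intro span_sum span_scale span_base) simp
  qed
qed

lemma range_proj:
  assumes "orthonormal x"
  shows "range (proj x) = span (range x)"
proof -
  have "(\<Sum>i\<in>UNIV. a i *\<^sub>R x i) = proj x (\<Sum>i\<in>UNIV. a i *\<^sub>R x i)" for a
    by (simp add: proj_def inner_orthonormal_sum[OF assms])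
  then have "span (range x) \<subseteq> range (proj x)"
    unfolding span_range_finite_eq by blast
  moreover have "range (proj x) \<subseteq> span (range x)"
    by (auto simp: span_range_finite_eq proj_def)
  ultimately show ?thesis by blast
qed

lemma dim_span_orthonormal:
  fixes x :: "'i::finite \<Rightarrow> 'a::euclidean_space"
  assumes x: "orthonormal x"
  shows "dim (span (range x)) = CARD('i)"
proof -
  have "inj x"
  proof (rule injI, rule ccontr)
    fix i j assume "x i = x j" "i \<noteq> j"
    then show False using orthonormalD[OF x, of i i] orthonormalD[OF x, of i j] by simp
  qed
  moreover have "independent (range x)"
  proof (rule pairwise_orthogonal_independent)
    show "pairwise orthogonal (range x)"
      by (auto simp: pairwise_def orthogonal_def orthonormalD[OF x])
    show "0 \<notin> range x" using norm_orthonormal[OF x] by (auto simp: image_iff) (metis norm_zero zero_neq_one)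
  qed
  ultimately show ?thesis by (simp add: dim_span dim_eq_card_independent card_image)
qed

lemma projector_range_iff: "projector p \<Longrightarrow> y \<in> range p \<longleftrightarrow> p y = y"
  by (metis projector_def rangeE rangeI)

lemma subspace_range_projector: "projector p \<Longrightarrow> subspace (range p)"
  by (simp add: projector_def linear_subspace_image)

lemma inner_projector_self: "projector p \<Longrightarrow> y \<bullet> p y = (norm (p y))\<^sup>2"
  by (metis power2_norm_eq_inner projector_def)

lemma norm_projector_Pythagoras:
  assumes "projector p"
  shows "(norm y)\<^sup>2 = (norm (p y))\<^sup>2 + (norm (y - p y))\<^sup>2"
  using inner_projector_self[OF assms, of y]
  by (simp add: power2_norm_eq_inner inner_diff inner_commute)

lemma norm_projector_le: "projector p \<Longrightarrow> norm (p y) \<le> norm y"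
  using norm_projector_Pythagoras[of p y] by (simp add: power2_le_imp_le)

section \<open>The tilt of a subspace against a projector\<close>

text \<open>
  With \<open>p\<close> the orthogonal projector onto a subspace \<open>T\<close> of the same dimension as \<open>S\<close>, this is the
  condition \<open>sin\<^sup>2 \<theta> \<le> s\<close> on the largest principal angle \<open>\<theta>\<close> between \<open>S\<close> and \<open>T\<close>; so
  \<open>tilt_le p s\<close> describes the ball in question without reference to representatives.
\<close>

definition tilt_le :: "('a::real_inner \<Rightarrow> 'a) \<Rightarrow> real \<Rightarrow> 'a set \<Rightarrow> bool" where
  "tilt_le p s S \<longleftrightarrow> (\<forall>y\<in>S. (norm (y - p y))\<^sup>2 \<le> s * (norm y)\<^sup>2)"

text \<open>
  Principal angles are symmetric. For \<open>s < 1\<close> the map \<open>p\<close> is injective on \<open>range q\<close>, hence onto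
  \<open>range p\<close> by equality of dimensions. Every \<open>v\<close> in \<open>range p\<close> is therefore \<open>p x\<close> for some \<open>x\<close> in
  \<open>range q\<close> that is not much longer than \<open>v\<close>, and \<open>\<bar>v\<bar>\<^sup>2 = q v \<bullet> x\<close> bounds \<open>q v\<close> from below.
\<close>

lemma tilt_le_swap:
  fixes p q :: "'a::euclidean_space \<Rightarrow> 'a"
  assumes p: "projector p" and q: "projector q" and dim: "dim (range p) = dim (range q)"
    and s: "s < 1" and tilt: "tilt_le p s (range q)"
  shows "tilt_le q s (range p)"
proof -
  have big: "(1 - s) * (norm x)\<^sup>2 \<le> (norm (p x))\<^sup>2" if "x \<in> range q" for x
  proof -
    have "(norm (x - p x))\<^sup>2 \<le> s * (norm x)\<^sup>2"
      using tilt that unfolding tilt_le_def by blast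
    then show ?thesis
      using norm_projector_Pythagoras[OF p, of x] by (simp add: left_diff_distrib)
  qed
  have lin: "linear p" using p by (simp add: projector_def)
  have sub: "subspace (range q)" by (rule subspace_range_projector[OF q])
  have "inj_on p (range q)"
  proof (subst linear_inj_on_iff_eq_0[OF lin sub], intro ballI impI)
    fix x assume "x \<in> range q" "p x = 0"
    then have "(1 - s) * (norm x)\<^sup>2 \<le> 0" using big[of x] by simp
    then show "x = 0" using s by (simp add: mult_le_0_iff)
  qed
  then have "dim (p ` range q) = dim (range q)"
    using lin sub by (intro dim_image_eq) (simp_all add: span_eq_iff[THEN iffD2])
  then have onto: "p ` range q = range p"
    using lin sub dim
    by (intro subspace_dim_equal) (auto simp: linear_subspace_image subspace_range_projector[OF p])
  have "(norm (v - q v))\<^sup>2 \<le> s * (norm v)\<^sup>2" if "v \<in> range p" for v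
  proof (cases "v = 0")
    case True
    then show ?thesis using q by (simp add: projector_def linear_0)
  next
    case False
    have "v \<in> p ` range q" using that onto by simp
    then obtain x where x: "v = p x" "x \<in> range q" by (rule imageE)
    have "(norm v)\<^sup>2 = v \<bullet> x"
      using x(1) inner_projector_self[OF p, of x] by (simp add: inner_commute)
    also have "\<dots> = q v \<bullet> x"
    proof -
      have "q v \<bullet> x = v \<bullet> q x" using q by (simp add: projector_def)
      then show ?thesis using projector_range_iff[OF q, of x] x(2) by simp
    qed
    also have "\<dots> \<le> norm (q v) * norm x" by (rule norm_cauchy_schwarz)
    finally have "((norm v)\<^sup>2)\<^sup>2 \<le> (norm (q v) * norm x)\<^sup>2" by (intro power_mono) auto
    then have "(1 - s) * ((norm v)\<^sup>2)\<^sup>2 \<le> (norm (q v))\<^sup>2 * ((1 - s) * (norm x)\<^sup>2)"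
      using s by (simp add: power_mult_distrib mult.left_commute)
    also have "\<dots> \<le> (norm (q v))\<^sup>2 * (norm v)\<^sup>2"
      using big[OF x(2)] x(1) by (intro mult_left_mono) auto
    finally have "(1 - s) * (norm v)\<^sup>2 \<le> (norm (q v))\<^sup>2"
      using False by (simp add: power2_eq_square)
    then show ?thesis using norm_projector_Pythagoras[OF q, of v] by (simp add: algebra_simps)
  qed
  then show ?thesis by (simp add: tilt_le_def)
qed

text \<open>
  If \<open>w\<close> is orthogonal to \<open>range p\<close>, then \<open>(norm (q w))\<^sup>2 = w \<bullet> q w\<close> sees only the part \<open>q w - p (q w)\<close>
  of \<open>q w\<close>, which is short because \<open>q w\<close> lies in \<open>range q\<close>.
\<close>

lemma tilt_le_orthogonal:
  assumes p: "projector p" and q: "projector q" and s: "0 \<le> s"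
    and tilt: "tilt_le p s (range q)" and w: "p w = 0"
  shows "(norm (q w))\<^sup>2 \<le> s * (norm w)\<^sup>2"
proof (cases "q w = 0")
  case True
  then show ?thesis using s by simp
next
  case False
  have "(norm (q w))\<^sup>2 = w \<bullet> (q w - p (q w))"
    using p w by (metis inner_projector_self[OF q] diff_zero inner_diff_right inner_zero_left projector_def)
  also have "\<dots> \<le> norm w * norm (q w - p (q w))" by (rule norm_cauchy_schwarz)
  finally have "((norm (q w))\<^sup>2)\<^sup>2 \<le> (norm w * norm (q w - p (q w)))\<^sup>2"
    by (intro power_mono) auto
  also have "\<dots> \<le> (norm w)\<^sup>2 * (s * (norm (q w))\<^sup>2)"
    using tilt by (auto simp: tilt_le_def power_mult_distrib intro!: mult_left_mono)
  finally show ?thesis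
    using False by (simp add: power2_eq_square mult.assoc mult.left_commute)
qed

text \<open>
  \<open>q - p\<close> splits as \<open>q (1 - p) - (1 - q) p\<close> with orthogonal values. The first part is controlled by
  the tilt of \<open>range q\<close>, the second by that of \<open>range p\<close>.
\<close>

lemma tilt_le_projector_distance:
  fixes p q :: "'a::euclidean_space \<Rightarrow> 'a"
  assumes p: "projector p" and q: "projector q" and dim: "dim (range p) = dim (range q)"
    and s: "0 \<le> s" "s < 1" and tilt: "tilt_le p s (range q)"
  shows "(norm (q z - p z))\<^sup>2 \<le> s * (norm z)\<^sup>2"
proof -
  define a b where "a = q (z - p z)" and "b = p z - q (p z)"
  have lin: "linear p" "linear q" and ip: "\<And>x. p (p x) = p x" and iq: "\<And>x. q (q x) = q x"
    using p q by (auto simp: projector_def)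
  have "q z - p z = a - b"
    by (simp add: a_def b_def linear_diff[OF lin(2)])
  moreover have "a \<bullet> b = 0"
  proof -
    have "a \<bullet> b = (z - p z) \<bullet> q b"
      using q by (simp add: a_def projector_def)
    also have "q b = 0" by (simp add: b_def linear_diff[OF lin(2)] iq)
    finally show ?thesis by simp
  qed
  ultimately have "(norm (q z - p z))\<^sup>2 = (norm a)\<^sup>2 + (norm b)\<^sup>2"
    by (simp add: power2_norm_eq_inner inner_diff inner_commute)
  moreover have "(norm a)\<^sup>2 \<le> s * (norm (z - p z))\<^sup>2"
    unfolding a_def
    by (rule tilt_le_orthogonal[OF p q s(1) tilt]) (simp add: linear_diff[OF lin(1)] ip)
  moreover have "(norm b)\<^sup>2 \<le> s * (norm (p z))\<^sup>2"
    using tilt_le_swap[OF p q dim s(2) tilt] by (auto simp: tilt_le_def b_def)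
  moreover have "s * (norm z)\<^sup>2 = s * (norm (p z))\<^sup>2 + s * (norm (z - p z))\<^sup>2"
    by (simp add: norm_projector_Pythagoras[OF p, of z] distrib_left)
  ultimately show ?thesis by simp
qed

definition reflection :: "('a::real_inner \<Rightarrow> 'a) \<Rightarrow> 'a \<Rightarrow> 'a" where
  "reflection p y = 2 *\<^sub>R p y - y"

lemma linear_reflection: "projector p \<Longrightarrow> linear (reflection p)"
  unfolding reflection_def projector_def
  by (intro linear_compose_sub linear_compose_scale_right linear_ident) auto

lemma reflection_adjoint: "projector p \<Longrightarrow> reflection p x \<bullet> y = x \<bullet> reflection p y"
  by (simp add: reflection_def inner_diff projector_def)

lemma reflection_reflection:
  assumes "projector p"
  shows "reflection p (reflection p y) = y"
proof -
  have "linear p" "p (p y) = p y" using assms by (simp_all add: projector_def)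
  then have "p (reflection p y) = p y"
    by (simp add: reflection_def linear_diff linear_add scaleR_2)
  then show ?thesis unfolding reflection_def[of p "reflection p y"]
    by (simp add: reflection_def)
qed

lemma inner_reflection_reflection:
  "projector p \<Longrightarrow> reflection p x \<bullet> reflection p y = x \<bullet> y"
  by (simp add: reflection_adjoint reflection_reflection)

text \<open>
  Reflections are isometries with \<open>reflection q - reflection p = 2 (q - p)\<close>, so a bound on \<open>q - p\<close>
  is a lower bound on an inner product that is linear in \<open>reflection q\<close>. This linearity allows the
  bounds at the two ends of a geodesic to be averaged.
\<close>

lemma tilt_le_reflection:
  fixes p q :: "'a::euclidean_space \<Rightarrow> 'a"
  assumes p: "projector p" and q: "projector q" and dim: "dim (range p) = dim (range q)"
    and s: "0 \<le> s" "s < 1" and tilt: "tilt_le p s (range q)"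
  shows "(1 - 2 * s) * (norm z)\<^sup>2 \<le> reflection q z \<bullet> reflection p z"
proof -
  have "reflection q z - reflection p z = 2 *\<^sub>R (q z - p z)"
    by (simp add: reflection_def algebra_simps)
  then have "(norm (reflection q z - reflection p z))\<^sup>2 \<le> 4 * (s * (norm z)\<^sup>2)"
    using tilt_le_projector_distance[OF assms, of z] by (simp add: power_mult_distrib)
  moreover have "(norm (reflection q z - reflection p z))\<^sup>2 =
      2 * (norm z)\<^sup>2 - 2 * (reflection q z \<bullet> reflection p z)"
    using inner_reflection_reflection[OF p, of z z] inner_reflection_reflection[OF q, of z z]
    by (simp add: power2_norm_eq_inner inner_diff inner_commute)
  ultimately show ?thesis by (simp add: algebra_simps)
qed

section \<open>Balls are closed under midpoints of geodesics\<close>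

text \<open>
  The columns of the factors of a compact SVD of a tangent vector. Orthogonality of \<open>u j\<close> to the
  \<open>x i\<close> can be demanded only if \<open>\<sigma> j \<noteq> 0\<close>, since a vanishing singular value removes \<open>u j\<close> from the
  tangent vector.
\<close>

definition horizontal :: "('i \<Rightarrow> 'a::real_inner) \<Rightarrow> ('i \<Rightarrow> 'a) \<Rightarrow> ('i \<Rightarrow> real) \<Rightarrow> bool" where
  "horizontal x u \<sigma> \<longleftrightarrow> orthonormal x \<and> orthonormal u \<and> (\<forall>i j. \<sigma> j \<noteq> 0 \<longrightarrow> x i \<bullet> u j = 0)"

definition geod :: "('i \<Rightarrow> 'a::real_inner) \<Rightarrow> ('i \<Rightarrow> 'a) \<Rightarrow> ('i \<Rightarrow> real) \<Rightarrow> real \<Rightarrow> 'i \<Rightarrow> 'a" where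
  "geod x u \<sigma> t i = cos (t * \<sigma> i) *\<^sub>R x i + sin (t * \<sigma> i) *\<^sub>R u i"

lemma inner_geod:
  assumes h: "horizontal x u \<sigma>"
  shows "geod x u \<sigma> s i \<bullet> geod x u \<sigma> t j = (if i = j then cos ((s - t) * \<sigma> i) else 0)"
proof -
  have x: "x i \<bullet> x j = (if i = j then 1 else 0)" and u: "u i \<bullet> u j = (if i = j then 1 else 0)"
    for i j using h by (auto simp: horizontal_def orthonormal_def)
  have xu: "sin (t * \<sigma> j) * (x i \<bullet> u j) = 0" for t i j
    using h by (cases "\<sigma> j = 0") (auto simp: horizontal_def)
  have "geod x u \<sigma> s i \<bullet> geod x u \<sigma> t j =
      cos (s * \<sigma> i) * cos (t * \<sigma> j) * (x i \<bullet> x j) + sin (s * \<sigma> i) * sin (t * \<sigma> j) * (u i \<bullet> u j) +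
      cos (s * \<sigma> i) * (sin (t * \<sigma> j) * (x i \<bullet> u j)) +
      cos (t * \<sigma> j) * (sin (s * \<sigma> i) * (x j \<bullet> u i))"
    by (simp add: geod_def inner_add inner_commute algebra_simps)
  then show ?thesis
    unfolding xu x u by (simp add: cos_diff left_diff_distrib)
qed

lemma orthonormal_geod: "horizontal x u \<sigma> \<Longrightarrow> orthonormal (geod x u \<sigma> t)"
  by (simp add: orthonormal_def inner_geod)

text \<open>
  In each plane spanned by \<open>x i\<close> and \<open>u i\<close> the two reflections are in lines enclosing the angle
  \<open>r * \<sigma> i\<close> with the line of \<open>geod x u \<sigma> c i\<close>, on either side; the sine parts cancel.
\<close>

lemma reflection_average_geod:
  fixes x :: "'i::finite \<Rightarrow> 'a::real_inner"
  assumes h: "horizontal x u \<sigma>"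
  shows "reflection (proj (geod x u \<sigma> (c - r))) (geod x u \<sigma> c i) +
      reflection (proj (geod x u \<sigma> (c + r))) (geod x u \<sigma> c i) =
    (2 * cos (2 * r * \<sigma> i)) *\<^sub>R geod x u \<sigma> c i"
proof -
  let ?z = "geod x u \<sigma>"
  have pr: "proj (?z t) (?z c i) = cos ((t - c) * \<sigma> i) *\<^sub>R ?z t i" for t
  proof -
    have "proj (?z t) (?z c i) = (\<Sum>j\<in>UNIV. if j = i then cos ((t - c) * \<sigma> i) *\<^sub>R ?z t i else 0)"
      unfolding proj_def by (intro sum.cong refl) (simp add: inner_geod[OF h])
    then show ?thesis by simp
  qed
  have co: "cos ((c - r) * \<sigma> i) + cos ((c + r) * \<sigma> i) = 2 * cos (r * \<sigma> i) * cos (c * \<sigma> i)"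
    by (simp add: left_diff_distrib distrib_right cos_diff cos_add)
  have si: "sin ((c - r) * \<sigma> i) + sin ((c + r) * \<sigma> i) = 2 * cos (r * \<sigma> i) * sin (c * \<sigma> i)"
    by (simp add: left_diff_distrib distrib_right sin_diff sin_add)
  have "?z (c - r) i + ?z (c + r) i =
      (cos ((c - r) * \<sigma> i) + cos ((c + r) * \<sigma> i)) *\<^sub>R x i +
      (sin ((c - r) * \<sigma> i) + sin ((c + r) * \<sigma> i)) *\<^sub>R u i"
    by (simp add: geod_def scaleR_left_distrib)
  also have "\<dots> = (2 * cos (r * \<sigma> i)) *\<^sub>R ?z c i"
    unfolding co si by (simp add: geod_def scaleR_right_distrib)
  finally have sum: "?z (c - r) i + ?z (c + r) i = (2 * cos (r * \<sigma> i)) *\<^sub>R ?z c i" .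
  have "reflection (proj (?z (c - r))) (?z c i) + reflection (proj (?z (c + r))) (?z c i) =
      (2 * cos (r * \<sigma> i)) *\<^sub>R (?z (c - r) i + ?z (c + r) i) - 2 *\<^sub>R ?z c i"
    by (simp add: reflection_def pr scaleR_2 scaleR_right_distrib)
  also have "\<dots> = (2 * (2 * (cos (r * \<sigma> i))\<^sup>2 - 1)) *\<^sub>R ?z c i"
    unfolding sum by (simp add: power2_eq_square algebra_simps)
  also have "2 * (cos (r * \<sigma> i))\<^sup>2 - 1 = cos (2 * r * \<sigma> i)"
    using cos_double_cos[of "r * \<sigma> i"] by (simp add: mult.assoc)
  finally show ?thesis .
qed

text \<open>
  Let \<open>q\<close> be the projector onto the midpoint and \<open>e\<close> a unit eigenvector of \<open>q p\<close> in \<open>range q\<close> for the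
  least eigenvalue \<open>m\<close>; the claim is \<open>m \<ge> 1 - s\<close>. Apply the bound of \<open>tilt_le_reflection\<close> at both ends to \<open>e\<close>
  and average. The averaged reflection maps \<open>e\<close> to a vector \<open>w\<close> that lies in \<open>range q\<close>, and for
  such vectors \<open>w \<bullet> reflection p e = (2 * m - 1) * (w \<bullet> e)\<close>. Hence
  \<open>1 - 2 * s \<le> (2 * m - 1) * (w \<bullet> e)\<close> with \<open>0 \<le> w \<bullet> e \<le> 1\<close>, which gives the claim unless
  \<open>w \<bullet> e = 0\<close>. In that case \<open>e\<close> involves only directions with vanishing cosine, and these are
  assumed to lie in \<open>range p\<close>.
\<close>

lemma tilt_le_midpoint:
  fixes x :: "'i::finite \<Rightarrow> 'a::euclidean_space"
  assumes h: "horizontal x u \<sigma>" and p: "projector p" and dim: "dim (range p) = CARD('i)"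
    and s: "0 \<le> s" "s \<le> 1/2"
    and tilt: "tilt_le p s (span (range (geod x u \<sigma> (c - r))))"
      "tilt_le p s (span (range (geod x u \<sigma> (c + r))))"
    and cos_nonneg: "\<And>i. 0 \<le> cos (2 * r * \<sigma> i)"
    and degenerate: "\<And>i. cos (2 * r * \<sigma> i) = 0 \<Longrightarrow> p (geod x u \<sigma> c i) = geod x u \<sigma> c i"
  shows "tilt_le p s (span (range (geod x u \<sigma> c)))"
proof -
  define z where "z = geod x u \<sigma> c"
  have on: "orthonormal (geod x u \<sigma> t)" for t using h by (rule orthonormal_geod)
  have onz: "orthonormal z" using on by (simp add: z_def)
  define q where "q = proj z"
  have q: "projector q" and rq: "range q = span (range z)"
    unfolding q_def using onz by (simp_all add: projector_proj range_proj)
  have lp: "linear p" and lq: "linear q" using p q by (simp_all add: projector_def)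
  have pa: "p y \<bullet> w = y \<bullet> p w" and qa: "q y \<bullet> w = y \<bullet> q w" for y w
    using p q by (simp_all add: projector_def)
  have fixq: "q y = y" if "y \<in> range q" for y
    using that projector_range_iff[OF q] by blast
  have zi: "z i \<in> range q" for i unfolding rq by (simp add: span_base)
  have nz: "range q \<noteq> {0}"
  proof
    assume "range q = {0}"
    then have "z undefined = 0" using zi by blast
    then show False using norm_orthonormal[OF onz, of undefined] by simp
  qed
  have sa: "(q \<circ> p) y \<bullet> w = y \<bullet> (q \<circ> p) w" if "y \<in> range q" "w \<in> range q" for y w
    using fixq[OF that(1)] fixq[OF that(2)] pa[of y w] qa[of "p y" w] qa[of y "p w"] by simp
  have img: "(q \<circ> p) ` range q \<subseteq> range q" by auto
  obtain e m where e: "e \<in> range q" "norm e = 1" "(q \<circ> p) e = m *\<^sub>R e"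
    and least: "\<And>y. y \<in> range q \<Longrightarrow> m * (norm y)\<^sup>2 \<le> y \<bullet> (q \<circ> p) y"
    using least_eigenvector[OF linear_compose[OF lp lq] subspace_range_projector[OF q] nz img sa]
    by metis
  obtain a where a: "e = (\<Sum>i\<in>UNIV. a i *\<^sub>R z i)"
    using e(1) unfolding rq span_range_finite_eq by blast
  define \<gamma> where "\<gamma> i = cos (2 * r * \<sigma> i)" for i
  \<comment> \<open>The image of \<open>e\<close> under the average of the two end reflections, see \<open>R0 e + R1 e = 2 *\<^sub>R w\<close> below.\<close>
  define w where "w = (\<Sum>i\<in>UNIV. (\<gamma> i * a i) *\<^sub>R z i)"
  have wq: "q w = w"
    unfolding w_def by (intro fixq) (simp add: rq span_sum span_scale span_base)
  have one: "(\<Sum>i\<in>UNIV. (a i)\<^sup>2) = 1"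
    using e(2) inner_orthonormal_sums[OF onz, of a a]
    by (simp add: a norm_eq_1 power2_eq_square)
  have we: "w \<bullet> e = (\<Sum>i\<in>UNIV. \<gamma> i * (a i)\<^sup>2)"
    unfolding w_def a inner_orthonormal_sums[OF onz] by (simp add: power2_eq_square mult.assoc)
  have we0: "0 \<le> w \<bullet> e"
    unfolding we using cos_nonneg by (intro sum_nonneg mult_nonneg_nonneg) (auto simp: \<gamma>_def)
  have we1: "w \<bullet> e \<le> 1"
  proof -
    have "w \<bullet> e \<le> (\<Sum>i\<in>UNIV. 1 * (a i)\<^sup>2)"
      unfolding we by (intro sum_mono mult_right_mono) (auto simp: \<gamma>_def)
    then show ?thesis using one by simp
  qed
  define R0 R1 where "R0 = reflection (proj (geod x u \<sigma> (c - r)))"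
    and "R1 = reflection (proj (geod x u \<sigma> (c + r)))"
  have lR: "linear R0" "linear R1"
    unfolding R0_def R1_def by (intro linear_reflection projector_proj on)+
  have "R0 e + R1 e = 2 *\<^sub>R w"
  proof -
    have "R0 e + R1 e = (\<Sum>i\<in>UNIV. a i *\<^sub>R (R0 (z i) + R1 (z i)))"
      by (simp add: a linear_sum[OF lR(1)] linear_sum[OF lR(2)] linear_scale[OF lR(1)]
          linear_scale[OF lR(2)] scaleR_right_distrib sum.distrib)
    also have "\<dots> = (\<Sum>i\<in>UNIV. a i *\<^sub>R ((2 * \<gamma> i) *\<^sub>R z i))"
      unfolding R0_def R1_def z_def \<gamma>_def reflection_average_geod[OF h] ..
    also have "\<dots> = 2 *\<^sub>R w" by (simp add: w_def scaleR_sum_right mult_ac)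
    finally show ?thesis .
  qed
  moreover have "(1 - 2 * s) * (norm e)\<^sup>2 \<le> reflection (proj (geod x u \<sigma> t)) e \<bullet> reflection p e"
    if "tilt_le p s (span (range (geod x u \<sigma> t)))" for t
    using that s dim by (intro tilt_le_reflection p projector_proj on)
      (simp_all add: range_proj[OF on] dim_span_orthonormal[OF on] del: dim_span)
  from this[OF tilt(1)] this[OF tilt(2)]
  have "2 * (1 - 2 * s) \<le> (R0 e + R1 e) \<bullet> reflection p e"
    using e(2) by (simp add: R0_def R1_def inner_add)
  ultimately have "1 - 2 * s \<le> w \<bullet> reflection p e" by simp
  also have "w \<bullet> reflection p e = 2 * (w \<bullet> p e) - w \<bullet> e"
    by (simp add: reflection_def inner_diff)
  also have "w \<bullet> p e = m * (w \<bullet> e)"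
    using qa[of w "p e"] wq e(3) by simp
  finally have key: "1 - 2 * s \<le> (2 * m - 1) * (w \<bullet> e)" by (simp add: algebra_simps)
  have "1 - s \<le> m"
  proof (cases "w \<bullet> e = 0")
    case True
    have "\<gamma> i * (a i)\<^sup>2 = 0" for i
      using True we cos_nonneg sum_nonneg_eq_0_iff[of UNIV "\<lambda>i. \<gamma> i * (a i)\<^sup>2"]
      by (simp add: \<gamma>_def)
    then have "a i *\<^sub>R p (z i) = a i *\<^sub>R z i" for i
      using degenerate[of i] by (auto simp: \<gamma>_def z_def)
    then have "p e = e" unfolding a linear_sum[OF lp] linear_scale[OF lp] by (intro sum.cong refl)
    then have "m *\<^sub>R e = 1 *\<^sub>R e" using e(3) fixq[OF e(1)] by simp
    moreover have "e \<noteq> 0" using e(2) by auto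
    ultimately have "m = 1" by (metis scaleR_cancel_right)
    then show ?thesis using s by simp
  next
    case False
    have "0 \<le> 2 * m - 1"
    proof (rule ccontr)
      assume "\<not> ?thesis"
      then have "(2 * m - 1) * (w \<bullet> e) < 0"
        using False we0 by (intro mult_neg_pos) auto
      then show False using key s by simp
    qed
    then have "(2 * m - 1) * (w \<bullet> e) \<le> 2 * m - 1"
      using we1 by (simp add: mult_left_le)
    then show ?thesis using key by simp
  qed
  have "(norm (y - p y))\<^sup>2 \<le> s * (norm y)\<^sup>2" if "y \<in> range q" for y
  proof -
    have "(1 - s) * (norm y)\<^sup>2 \<le> m * (norm y)\<^sup>2"
      using \<open>1 - s \<le> m\<close> by (intro mult_right_mono) auto
    also have "\<dots> \<le> y \<bullet> p y"
      using least[OF that] qa[of y "p y"] fixq[OF that] by simp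
    finally show ?thesis
      using norm_projector_Pythagoras[OF p, of y]
      by (simp add: inner_projector_self[OF p] algebra_simps)
  qed
  then show ?thesis unfolding tilt_le_def rq z_def by blast
qed

lemma tilt_le_span_range:
  fixes x :: "'i::finite \<Rightarrow> 'a::real_inner"
  shows "tilt_le p s (span (range x)) \<longleftrightarrow>
    (\<forall>a. (norm ((\<Sum>i\<in>UNIV. a i *\<^sub>R x i) - p (\<Sum>i\<in>UNIV. a i *\<^sub>R x i)))\<^sup>2
      \<le> s * (norm (\<Sum>i\<in>UNIV. a i *\<^sub>R x i))\<^sup>2)"
  unfolding tilt_le_def span_range_finite_eq by auto

section \<open>Geodesic convexity of balls\<close>

lemma closed_tilt_le_geod:
  fixes x :: "'i::finite \<Rightarrow> 'a::euclidean_space"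
  assumes "linear p"
  shows "closed {t. tilt_le p s (span (range (geod x u \<sigma> t)))}"
proof -
  have p: "continuous_on UNIV p" using assms by (simp add: linear_continuous_on linear_conv_bounded_linear)
  have pg: "continuous_on UNIV (\<lambda>t. p (g t))" if "continuous_on UNIV g" for g :: "real \<Rightarrow> 'a"
    by (rule continuous_on_compose2[OF p that]) simp
  then show ?thesis
    unfolding tilt_le_span_range geod_def
    by (intro closed_Collect_all closed_Collect_le continuous_intros pg)
qed

text \<open>
  The parameters at which the geodesic lies in the ball form a closed set, and it contains the midpoint
  of any two of its elements. It therefore has no gaps: the end points of a gap would have
  their midpoint inside the gap. Only if these end points are 0 and 1 can an
  angle between them be a right angle.
\<close>

lemma tilt_le_geodesic_segment:
  fixes x :: "'i::finite \<Rightarrow> 'a::euclidean_space"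
  assumes h: "horizontal x u \<sigma>" and p: "projector p" and dim: "dim (range p) = CARD('i)"
    and s: "0 \<le> s" "s \<le> 1/2"
    and \<sigma>: "\<And>i. 0 \<le> \<sigma> i" "\<And>i. \<sigma> i \<le> pi / 2"
    and ends: "tilt_le p s (span (range (geod x u \<sigma> 0)))"
      "tilt_le p s (span (range (geod x u \<sigma> 1)))"
    and right_angle: "\<And>i. \<sigma> i = pi / 2 \<Longrightarrow> p (geod x u \<sigma> (1/2) i) = geod x u \<sigma> (1/2) i"
    and t: "t \<in> {0..1}"
  shows "tilt_le p s (span (range (geod x u \<sigma> t)))"
proof (rule ccontr)
  define T where "T = {t. tilt_le p s (span (range (geod x u \<sigma> t)))}"
  assume "\<not> ?thesis"
  then have tT: "t \<notin> T" by (simp add: T_def)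
  have "closed T" unfolding T_def using p by (intro closed_tilt_le_geod) (simp add: projector_def)
  then have "compact (T \<inter> {0..t})" "compact (T \<inter> {t..1})" by (simp_all add: closed_Int_compact)
  moreover have "0 \<in> T \<inter> {0..t}" "1 \<in> T \<inter> {t..1}" using ends t by (auto simp: T_def)
  ultimately obtain a b where a: "a \<in> T \<inter> {0..t}" "\<And>y. y \<in> T \<inter> {0..t} \<Longrightarrow> y \<le> a"
    and b: "b \<in> T \<inter> {t..1}" "\<And>y. y \<in> T \<inter> {t..1} \<Longrightarrow> b \<le> y"
    using compact_attains_sup[of "T \<inter> {0..t}"] compact_attains_inf[of "T \<inter> {t..1}"] by blast
  define c r where "c = (a + b) / 2" and "r = (b - a) / 2"
  have "a < t" "t < b" using a(1) b(1) tT by (auto simp: order_less_le)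
  have r: "0 < 2 * r" "2 * r \<le> 1" using \<open>a < t\<close> \<open>t < b\<close> a(1) b(1) by (auto simp: r_def)
  have ang: "0 \<le> 2 * r * \<sigma> i" "2 * r * \<sigma> i \<le> \<sigma> i" for i
    using r \<sigma>(1)[of i] by (auto simp: mult_left_le_one_le)
  have "tilt_le p s (span (range (geod x u \<sigma> c)))"
  proof (rule tilt_le_midpoint[OF h p dim s])
    have "c - r = a" "c + r = b" by (simp_all add: c_def r_def field_simps)
    then show "tilt_le p s (span (range (geod x u \<sigma> (c - r))))"
      "tilt_le p s (span (range (geod x u \<sigma> (c + r))))"
      using a(1) b(1) by (simp_all add: T_def)
    fix i
    show "0 \<le> cos (2 * r * \<sigma> i)" using ang[of i] \<sigma>(2)[of i] by (intro cos_ge_zero) auto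
    assume "cos (2 * r * \<sigma> i) = 0"
    then have right: "2 * r * \<sigma> i = pi / 2"
      using ang[of i] \<sigma>(2)[of i] cos_gt_zero_pi[of "2 * r * \<sigma> i"] by fastforce
    then have si: "\<sigma> i = pi / 2" using ang[of i] \<sigma>(2)[of i] by simp
    then have "2 * r = 1" using right pi_gt_zero by (simp add: field_simps)
    then have ab: "a = 0" "b = 1" using a(1) b(1) by (auto simp: r_def)
    have c: "c = 1/2" unfolding c_def ab by simp
    show "p (geod x u \<sigma> c i) = geod x u \<sigma> c i"
      unfolding c by (rule right_angle[OF si])
  qed
  then have cT: "c \<in> T" by (simp add: T_def)
  have "a < c" "c < b" "0 \<le> c" "c \<le> 1"
    using \<open>a < t\<close> \<open>t < b\<close> a(1) b(1) by (auto simp: c_def)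
  then show False using a(2)[of c] b(2)[of c] cT by (cases "c \<le> t") auto
qed

text \<open>
  The vector \<open>x\<close> lies in \<open>range q\<close> and is orthogonal to \<open>range r\<close>, so the reflections in these
  subspaces act on it with opposite signs. Hence the forms \<open>z \<mapsto> reflection q z \<bullet> reflection p z\<close> and
  \<open>z \<mapsto> reflection r z \<bullet> reflection p z\<close>, both nonnegative, vanish at \<open>x\<close>. By
  \<open>nonneg_form_null_vector\<close> the reflection in \<open>range p\<close> then anticommutes on \<open>x\<close> with both
  of them, and the mirror image of \<open>x\<close> has both signs exchanged.
\<close>

lemma reflection_exchanges_right_angles:
  fixes p q r :: "'a::euclidean_space \<Rightarrow> 'a"
  assumes p: "projector p" and q: "projector q" and r: "projector r"
    and dim: "dim (range p) = dim (range q)" "dim (range p) = dim (range r)"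
    and s: "0 \<le> s" "s \<le> 1/2"
    and tilt: "tilt_le p s (range q)" "tilt_le p s (range r)"
    and x: "q x = x" "r x = 0"
  shows "q (reflection p x) = 0" "r (reflection p x) = reflection p x"
proof -
  have s1: "s < 1" using s by simp
  \<comment> \<open>The self-adjoint operator of the form \<open>2 * (reflection g z \<bullet> reflection p z)\<close>.\<close>
  define F where "F g z = reflection p (reflection g z) + reflection g (reflection p z)" for g z
  have ref: "projector g \<Longrightarrow> reflection g y \<bullet> z = y \<bullet> reflection g z" for g :: "'a \<Rightarrow> 'a" and y z
    by (rule reflection_adjoint)
  have form: "z \<bullet> F g z = 2 * (reflection g z \<bullet> reflection p z)" if "projector g" for g z
    using ref[OF p, of z "reflection g z"] ref[OF that, of z "reflection p z"]
      inner_commute[of "reflection p z" "reflection g z"]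
    unfolding F_def inner_add_right by linarith
  have null: "F g x = 0" if g: "projector g" and d: "dim (range p) = dim (range g)"
    and t: "tilt_le p s (range g)" and 0: "reflection g x \<bullet> reflection p x = 0" for g
  proof -
    have lin: "linear (F g)"
      using linear_reflection[OF g] linear_reflection[OF p]
      by (intro linearI) (simp_all add: F_def linear_add linear_scale scaleR_right_distrib)
    have "F g x \<bullet> F g x = 0"
    proof (rule nonneg_form_null_vector[OF lin subspace_UNIV])
      show "F g y \<bullet> z = y \<bullet> F g z" for y z
        by (simp add: F_def inner_add ref[OF g] ref[OF p])
      show "0 \<le> y \<bullet> F g y" for y
      proof -
        have "0 \<le> (1 - 2 * s) * (norm y)\<^sup>2" using s by simp
        then show ?thesis
          using tilt_le_reflection[OF p g d s(1) s1 t, of y] form[OF g, of y] by linarith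
      qed
      show "x \<bullet> F g x = 0" using form[OF g, of x] 0 by simp
    qed auto
    then show ?thesis by simp
  qed
  have qx: "reflection q x = x" and rx: "reflection r x = - x"
    by (simp_all add: reflection_def x scaleR_2)
  have "0 \<le> (1 - 2 * s) * (norm x)\<^sup>2" using s by simp
  then have "x \<bullet> reflection p x = 0"
    using tilt_le_reflection[OF p q dim(1) s(1) s1 tilt(1), of x]
      tilt_le_reflection[OF p r dim(2) s(1) s1 tilt(2), of x] by (simp add: qx rx)
  then have F0: "F q x = 0" "F r x = 0"
    using null[OF q dim(1) tilt(1)] null[OF r dim(2) tilt(2)] by (simp_all add: qx rx)
  define w where "w = reflection p x"
  have "reflection p (- x) = - w"
    using linear_reflection[OF p] by (simp add: w_def linear_neg)
  then have "w + (2 *\<^sub>R q w - w) = 0" "- w + (2 *\<^sub>R r w - w) = 0"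
    using F0 unfolding F_def qx rx w_def[symmetric] by (simp_all add: reflection_def[of q w]
        reflection_def[of r w])
  moreover have "- w + (2 *\<^sub>R r w - w) = 2 *\<^sub>R (r w - w)"
    by (simp add: scaleR_2)
  ultimately show "q (reflection p x) = 0" "r (reflection p x) = reflection p x"
    by (simp_all add: w_def)
qed

text \<open>
  Principal vectors: the \<open>x i\<close> are eigenvectors of \<open>q r\<close> on \<open>range q\<close>, and \<open>y i\<close> is the normalized
  projection of \<open>x i\<close> onto \<open>range r\<close>, at the angle \<open>\<sigma> i\<close> from \<open>x i\<close>. If \<open>x i\<close> is
  orthogonal to \<open>range r\<close>, this projection is zero and the partner \<open>y i\<close> is not determined. The
  choice matters: a wrong sign leads out of the ball. The mirror image of \<open>x i\<close> in \<open>range p\<close> is an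
  admissible partner by \<open>reflection_exchanges_right_angles\<close>, and with it the midpoint of
  \<open>x i\<close> and \<open>y i\<close> lies in \<open>range p\<close>, as \<open>tilt_le_geodesic_segment\<close> demands.
\<close>

lemma connecting_geodesic:
  fixes p q r :: "'a::euclidean_space \<Rightarrow> 'a"
  assumes p: "projector p" and q: "projector q" and r: "projector r"
    and dim: "dim (range p) = CARD('i)" "dim (range q) = CARD('i)"
      "dim (range r) = CARD('i)"
    and s: "0 \<le> s" "s \<le> 1/2"
    and tilt: "tilt_le p s (range q)" "tilt_le p s (range r)"
  obtains x u :: "'i::finite \<Rightarrow> 'a" and \<sigma> where "horizontal x u \<sigma>"
    "span (range (geod x u \<sigma> 0)) = range q" "span (range (geod x u \<sigma> 1)) = range r"
    "\<And>i. 0 \<le> \<sigma> i" "\<And>i. \<sigma> i \<le> pi / 2"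
    "\<And>i. \<sigma> i = pi / 2 \<Longrightarrow> p (geod x u \<sigma> (1/2) i) = geod x u \<sigma> (1/2) i"
proof -
  have lin: "linear p" "linear q" "linear r"
    using p q r by (simp_all add: projector_def)
  have qa: "q y \<bullet> w = y \<bullet> q w" and ra: "r y \<bullet> w = y \<bullet> r w" and rr: "r (r y) = r y" for y w
    using q r by (simp_all add: projector_def)
  have qfix: "q y = y" if "y \<in> range q" for y
    using that projector_range_iff[OF q] by blast
  have sa: "(q \<circ> r) y \<bullet> w = y \<bullet> (q \<circ> r) w" if "y \<in> range q" "w \<in> range q" for y w
    using qfix[OF that(1)] qfix[OF that(2)] ra[of y w] qa[of "r y" w] qa[of y "r w"] by simp
  have img: "(q \<circ> r) ` range q \<subseteq> range q" by auto
  obtain B where B: "B \<subseteq> range q" "finite B" "card B = dim (range q)" "pairwise orthogonal B"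
    "\<And>b. b \<in> B \<Longrightarrow> norm b = 1 \<and> (\<exists>\<mu>. (q \<circ> r) b = \<mu> *\<^sub>R b)"
    using orthonormal_eigenbasis[OF linear_compose[OF lin(3,2)] subspace_range_projector[OF q] img sa]
    by metis
  obtain x :: "'i \<Rightarrow> 'a" where x: "bij_betw x UNIV B"
    using finite_same_card_bij[of "UNIV :: 'i set" B] B(2,3) dim(2) by auto
  have xB: "x i \<in> B" for i using x by (auto simp: bij_betw_def)
  have onx: "orthonormal x"
    unfolding orthonormal_def
  proof (intro allI)
    fix i j
    show "x i \<bullet> x j = (if i = j then 1 else 0)"
    proof (cases "i = j")
      case True
      then show ?thesis using B(5)[OF xB[of j]] by (simp add: norm_eq_1)
    next
      case False
      then have "x i \<noteq> x j" using x by (auto simp: bij_betw_def inj_on_def)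
      then show ?thesis using False B(4) xB by (auto simp: pairwise_def orthogonal_def)
    qed
  qed
  have qx: "q (x i) = x i" for i using xB B(1) by (intro qfix) auto
  obtain \<mu> where \<mu>: "\<And>i. q (r (x i)) = \<mu> i *\<^sub>R x i"
    using B(5)[OF xB] unfolding o_def by metis
  have xr: "x i \<bullet> r (x j) = (if i = j then \<mu> i else 0)" for i j
    using qa[of "x i" "r (x j)"] by (simp add: qx \<mu> orthonormalD[OF onx])
  have rx: "r (x i) \<bullet> r (x j) = (if i = j then \<mu> i else 0)" for i j
    using ra[of "x i" "r (x j)"] xr[of i j] by (simp add: rr)
  have \<mu>_norm: "\<mu> i = (norm (r (x i)))\<^sup>2" for i
    using rx[of i i] by (simp add: power2_norm_eq_inner)
  define c where "c i = norm (r (x i))" for i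
  have c: "0 \<le> c i" "c i \<le> 1" "\<mu> i = c i * c i" for i
    using norm_projector_le[OF r, of "x i"] norm_orthonormal[OF onx]
    by (simp_all add: c_def \<mu>_norm power2_eq_square)
  have right: "q (reflection p (x i)) = 0" "r (reflection p (x i)) = reflection p (x i)"
    if "c i = 0" for i
    using reflection_exchanges_right_angles[OF p q r _ _ s tilt, of "x i"] that dim qx
    by (simp_all add: c_def)
  define y where "y i = (if c i = 0 then reflection p (x i) else r (x i) /\<^sub>R c i)" for i
  have ry: "r (y i) = y i" for i
    by (simp add: y_def right linear_scale[OF lin(3)] rr)
  have xy: "x i \<bullet> y j = (if i = j then c i else 0)" for i j
  proof (cases "c j = 0")
    case True
    have "x i \<bullet> reflection p (x j) = x i \<bullet> q (reflection p (x j))"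
      using qa[of "x i" "reflection p (x j)"] by (simp add: qx)
    then show ?thesis using True by (simp add: y_def right)
  next
    case False
    then show ?thesis by (simp add: y_def xr c(3))
  qed
  have ony: "orthonormal y"
    unfolding orthonormal_def
  proof (intro allI)
    fix i j
    have mixed: "y i \<bullet> y j = 0" if "c i = 0" "c j \<noteq> 0" for i j
    proof -
      have "y i \<bullet> y j = (y i \<bullet> r (x j)) / c j" using that by (simp add: y_def field_simps)
      also have "y i \<bullet> r (x j) = x j \<bullet> y i"
        using ra[of "y i" "x j"] by (simp add: ry inner_commute)
      also have "\<dots> = 0" using xy[of j i] that by auto
      finally show ?thesis by simp
    qed
    show "y i \<bullet> y j = (if i = j then 1 else 0)"
    proof (cases "c i = 0"; cases "c j = 0")
      assume "c i = 0" "c j = 0"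
      then show ?thesis
        by (simp add: y_def inner_reflection_reflection[OF p] orthonormalD[OF onx])
    next
      assume "c i \<noteq> 0" "c j \<noteq> 0"
      then show ?thesis by (auto simp: y_def rx c(3) field_simps)
    next
      assume "c i = 0" "c j \<noteq> 0"
      then show ?thesis using mixed[of i j] by auto
    next
      assume "c i \<noteq> 0" "c j = 0"
      then show ?thesis using mixed[of j i] by (auto simp: inner_commute)
    qed
  qed
  define \<sigma> where "\<sigma> i = arccos (c i)" for i
  have \<sigma>: "0 \<le> \<sigma> i" "\<sigma> i \<le> pi / 2" "cos (\<sigma> i) = c i" for i
    using c[of i] using arccos_le_pi2[of "c i"] by (simp_all add: \<sigma>_def arccos_lbound cos_arccos)
  have sin_pos: "0 < sin (\<sigma> i)" if "c i \<noteq> 1" for i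
  proof -
    have "\<sigma> i \<noteq> 0" using \<sigma>(3)[of i] that by auto
    then show ?thesis using \<sigma>(1,2)[of i] pi_gt_zero by (intro sin_gt_zero) auto
  qed
  have sin2: "sin (\<sigma> i) * sin (\<sigma> i) = 1 - c i * c i" for i
    using sin_cos_squared_add[of "\<sigma> i"] \<sigma>(3)[of i] by (simp add: power2_eq_square)
  \<comment> \<open>For \<open>c i = 1\<close> the vectors \<open>x i\<close> and \<open>y i\<close> coincide and give no direction; reusing \<open>x i\<close> keeps \<open>u\<close> orthonormal, as the other \<open>u j\<close> are orthogonal to it.\<close>
  define u where "u i = (if c i = 1 then x i else (y i - c i *\<^sub>R x i) /\<^sub>R sin (\<sigma> i))" for i
  have xu: "x i \<bullet> u j = 0" if "c j \<noteq> 1" for i j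
    using that by (simp add: u_def inner_diff xy orthonormalD[OF onx])
  have onu: "orthonormal u"
    unfolding orthonormal_def
  proof (intro allI)
    fix i j
    show "u i \<bullet> u j = (if i = j then 1 else 0)"
    proof (cases "c i = 1"; cases "c j = 1")
      assume "c i = 1" "c j = 1"
      then show ?thesis by (simp add: u_def orthonormalD[OF onx])
    next
      assume ij: "c i \<noteq> 1" "c j \<noteq> 1"
      have "(y i - c i *\<^sub>R x i) \<bullet> (y j - c j *\<^sub>R x j) = (if i = j then 1 - c i * c i else 0)"
        using xy[of i j] xy[of j i]
        by (simp add: inner_diff orthonormalD[OF onx] orthonormalD[OF ony] inner_commute)
      then show ?thesis
        using ij sin_pos[of i] by (auto simp: u_def divide_simps simp flip: sin2)
    next
      assume "c i = 1" "c j \<noteq> 1"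
      then show ?thesis using xu[of j i] by (auto simp: u_def[of i])
    next
      assume "c i \<noteq> 1" "c j = 1"
      then show ?thesis using xu[of i j] by (auto simp: u_def[of j] inner_commute)
    qed
  qed
  have hor: "horizontal x u \<sigma>"
  proof -
    have "c j \<noteq> 1" if "\<sigma> j \<noteq> 0" for j using that by (auto simp: \<sigma>_def)
    then show ?thesis unfolding horizontal_def using onx onu xu by blast
  qed
  have z0: "geod x u \<sigma> 0 = x" by (simp add: fun_eq_iff geod_def)
  have z1: "geod x u \<sigma> 1 = y"
  proof
    fix i
    show "geod x u \<sigma> 1 i = y i"
    proof (cases "c i = 1")
      case True
      have "(x i - y i) \<bullet> (x i - y i) = 0"
        using True xy[of i i]
        by (simp add: inner_diff orthonormalD[OF onx] orthonormalD[OF ony] inner_commute)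
      then show ?thesis using True by (simp add: geod_def \<sigma>_def)
    next
      case False
      then show ?thesis using sin_pos[of i] by (simp add: geod_def u_def \<sigma>(3))
    qed
  qed
  have "span (range x) = range q"
    using qx dim(2) dim_span_orthonormal[OF onx]
    by (intro subspace_dim_equal span_minimal subspace_range_projector q)
      (auto simp: projector_range_iff[OF q] simp del: dim_span)
  moreover have "span (range y) = range r"
    using ry dim(3) dim_span_orthonormal[OF ony]
    by (intro subspace_dim_equal span_minimal subspace_range_projector r)
      (auto simp: projector_range_iff[OF r] simp del: dim_span)
  moreover have "p (geod x u \<sigma> (1/2) i) = geod x u \<sigma> (1/2) i" if "\<sigma> i = pi / 2" for i
  proof -
    have "c i = 0" using \<sigma>(3)[of i] that by simp
    moreover have "sin (\<sigma> i) = 1" unfolding that by simp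
    ultimately have "x i + u i = 2 *\<^sub>R p (x i)"
      by (simp add: u_def y_def reflection_def)
    moreover have "geod x u \<sigma> (1/2) i = (sqrt 2 / 2) *\<^sub>R (x i + u i)"
      by (simp add: geod_def that cos_45 sin_45 scaleR_right_distrib)
    ultimately have "geod x u \<sigma> (1/2) i = sqrt 2 *\<^sub>R p (x i)" by simp
    then show ?thesis using p by (simp add: linear_scale[OF lin(1)] projector_def)
  qed
  ultimately show thesis
    using that[OF hor] \<sigma> unfolding z0 z1 by blast
qed

section \<open>Convexity of the trace along geodesics\<close>

text \<open>
  The second derivative of the function is \<open>2 * (\<sigma> i)\<^sup>2\<close> times the difference of the two sides of
  the hypothesis, whose left side is the form at the normalized velocity of \<open>geod x u \<sigma> t i\<close>.
\<close>

lemma convex_on_geod_term: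
  fixes f :: "'a::euclidean_space \<Rightarrow> 'a"
  assumes f: "linear f"
    and dom: "\<And>t. t \<in> {0..1} \<Longrightarrow> \<sigma> i \<noteq> 0 \<Longrightarrow>
      (cos (t * \<sigma> i) *\<^sub>R u i - sin (t * \<sigma> i) *\<^sub>R x i) \<bullet> f (cos (t * \<sigma> i) *\<^sub>R u i - sin (t * \<sigma> i) *\<^sub>R x i)
        \<le> geod x u \<sigma> t i \<bullet> f (geod x u \<sigma> t i)"
  shows "convex_on {0..1} (\<lambda>t. - (geod x u \<sigma> t i \<bullet> f (geod x u \<sigma> t i)))"
proof -
  define a b d where "a = x i \<bullet> f (x i)" and "b = x i \<bullet> f (u i) + u i \<bullet> f (x i)"
    and "d = u i \<bullet> f (u i)"
  define c s where "c t = cos (t * \<sigma> i)" and "s t = sin (t * \<sigma> i)" for t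
  have z: "geod x u \<sigma> t i \<bullet> f (geod x u \<sigma> t i) = (c t)\<^sup>2 * a + c t * s t * b + (s t)\<^sup>2 * d" for t
    by (simp add: geod_def linear_add[OF f] linear_scale[OF f] inner_add a_def b_def d_def c_def s_def
        power2_eq_square algebra_simps)
  have w: "(c t *\<^sub>R u i - s t *\<^sub>R x i) \<bullet> f (c t *\<^sub>R u i - s t *\<^sub>R x i) =
      (s t)\<^sup>2 * a - c t * s t * b + (c t)\<^sup>2 * d" for t
    by (simp add: linear_diff[OF f] linear_scale[OF f] inner_diff a_def b_def d_def
        power2_eq_square algebra_simps)
  have [derivative_intros]: "(c has_real_derivative - \<sigma> i * s t) (at t)"
    "(s has_real_derivative \<sigma> i * c t) (at t)" for t
    unfolding c_def[abs_def] s_def[abs_def] by (auto intro!: derivative_eq_intros)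
  define g' where "g' t = - \<sigma> i * (2 * c t * s t * (d - a) + ((c t)\<^sup>2 - (s t)\<^sup>2) * b)" for t
  define g'' where "g'' t = 2 * (\<sigma> i)\<^sup>2 * (((c t)\<^sup>2 - (s t)\<^sup>2) * (a - d) + 2 * c t * s t * b)" for t
  show ?thesis
    unfolding z
  proof (rule f''_ge0_imp_convex[where f' = g' and f'' = g''])
    fix t :: real
    assume t: "t \<in> {0..1}"
    show "((\<lambda>t. - ((c t)\<^sup>2 * a + c t * s t * b + (s t)\<^sup>2 * d)) has_real_derivative g' t) (at t)"
      by (rule derivative_eq_intros refl)+ (simp add: g'_def power2_eq_square algebra_simps)
    show "(g' has_real_derivative g'' t) (at t)"
      unfolding g'_def[abs_def]
      by (rule derivative_eq_intros refl)+ (simp add: g''_def power2_eq_square algebra_simps)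
    show "0 \<le> g'' t"
    proof (cases "\<sigma> i = 0")
      case False
      have "0 \<le> ((c t)\<^sup>2 - (s t)\<^sup>2) * (a - d) + 2 * c t * s t * b"
        using dom[OF t False] unfolding z c_def[symmetric] s_def[symmetric] w
        by (simp add: algebra_simps)
      then show ?thesis by (simp add: g''_def)
    qed (simp add: g''_def)
  qed simp
qed

lemma convex_on_eq:
  assumes g: "convex_on S g" and eq: "\<And>t. t \<in> S \<Longrightarrow> f t = g t"
  shows "convex_on S f"
  unfolding convex_on_def
proof (intro conjI ballI allI impI)
  show S: "convex S" using g by (simp add: convex_on_def)
  fix x y and u v :: real
  assume "x \<in> S" "y \<in> S" "0 \<le> u" "0 \<le> v" "u + v = 1"
  moreover from this have "u *\<^sub>R x + v *\<^sub>R y \<in> S" by (rule convexD[OF S])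
  ultimately show "f (u *\<^sub>R x + v *\<^sub>R y) \<le> u * f x + v * f y"
    using g by (simp add: eq convex_on_def)
qed

lemma convex_on_sum_functions:
  assumes "finite I" "convex S" "\<And>i. i \<in> I \<Longrightarrow> convex_on S (f i)"
  shows "convex_on S (\<lambda>t. \<Sum>i\<in>I. f i t :: real)"
  using assms(1,3)
proof (induction I rule: finite_induct)
  case empty
  then show ?case using assms(2) by (simp add: convex_on_def)
next
  case (insert i I)
  then show ?case by (simp add: convex_on_add)
qed

text \<open>
  At each time the curve vectors lie in a subspace of tilt at most \<open>s\<close> and the normalized velocities are
  orthogonal to it. By symmetry of the tilt the former have at least the share \<open>1 - s\<close> of their
  squared length in \<open>range p\<close>, the latter at most the share \<open>s\<close>. The two bounds on the form thus
  compare its values at both, and the sum can be treated term by term.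
\<close>

lemma convex_on_geod_trace:
  fixes f p :: "'a::euclidean_space \<Rightarrow> 'a" and x u :: "'i::finite \<Rightarrow> 'a"
  assumes f: "linear f" and h: "horizontal x u \<sigma>"
    and p: "projector p" and dim: "dim (range p) = CARD('i)" and s: "0 \<le> s" "s < 1"
    and lower: "\<And>y. l * (norm (p y))\<^sup>2 \<le> y \<bullet> f y" and l: "0 \<le> l"
    and upper: "\<And>y. y \<bullet> f y \<le> L * (norm (p y))\<^sup>2 + l' * (norm (y - p y))\<^sup>2" and L: "l' \<le> L"
    and gap: "L * s + l' * (1 - s) \<le> l * (1 - s)"
    and tilt: "\<And>t. t \<in> {0..1} \<Longrightarrow> tilt_le p s (span (range (geod x u \<sigma> t)))"
  shows "convex_on {0..1} (\<lambda>t. - (\<Sum>i\<in>UNIV. geod x u \<sigma> t i \<bullet> f (geod x u \<sigma> t i)))"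
  unfolding sum_negf[symmetric]
proof (intro convex_on_sum_functions convex_on_geod_term f)
  fix i t
  assume t: "t \<in> {0..1::real}" and i: "\<sigma> i \<noteq> 0"
  define z where "z = geod x u \<sigma> t"
  define q where "q = proj z"
  define w where "w = cos (t * \<sigma> i) *\<^sub>R u i - sin (t * \<sigma> i) *\<^sub>R x i"
  have on: "orthonormal z" using orthonormal_geod[OF h] by (simp add: z_def)
  have q: "projector q" and rq: "range q = span (range z)"
    using on by (simp_all add: q_def projector_proj range_proj)
  have tq: "tilt_le p s (range q)" using tilt[OF t] by (simp add: rq z_def)
  have dq: "dim (range q) = CARD('i)"
    unfolding rq by (rule dim_span_orthonormal[OF on])
  have x: "x j \<bullet> x k = (if j = k then 1 else 0)" and u: "u j \<bullet> u k = (if j = k then 1 else 0)"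
    for j k using h by (auto simp: horizontal_def orthonormal_def)
  have xu: "x j \<bullet> u i = 0" for j using h i by (simp add: horizontal_def)
  have xu': "sin (t * \<sigma> j) * (x k \<bullet> u j) = 0" for j k
    using h by (cases "\<sigma> j = 0") (auto simp: horizontal_def)
  have "z j \<bullet> w = 0" for j
    using xu'[of j i]
    by (auto simp: z_def geod_def w_def inner_add inner_diff x u xu inner_commute[of "u j" "x i"])
  then have qw: "q w = 0" by (simp add: q_def proj_def)
  have w1: "(norm w)\<^sup>2 = 1"
    unfolding power2_norm_eq_inner w_def inner_diff inner_scaleR
    by (simp add: x u xu inner_commute[of "u i" "x i"] flip: power2_eq_square)
  have z1: "(norm (z i))\<^sup>2 = 1" using norm_orthonormal[OF on] by simp
  have "z i \<in> range q" unfolding rq by (simp add: span_base)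
  then have "(norm (z i - p (z i)))\<^sup>2 \<le> s * (norm (z i))\<^sup>2"
    using tq unfolding tilt_le_def by blast
  then have pz: "1 - s \<le> (norm (p (z i)))\<^sup>2"
    using norm_projector_Pythagoras[OF p, of "z i"] z1 by simp
  have pw: "(norm (p w))\<^sup>2 \<le> s"
    using tilt_le_orthogonal[OF q p s(1) tilt_le_swap[OF p q _ s(2) tq] qw] dim dq w1 by simp
  have "w \<bullet> f w \<le> L * (norm (p w))\<^sup>2 + l' * (1 - (norm (p w))\<^sup>2)"
  proof -
    have "(norm (w - p w))\<^sup>2 = 1 - (norm (p w))\<^sup>2"
      using norm_projector_Pythagoras[OF p, of w] w1 by simp
    then show ?thesis using upper[of w] by simp
  qed
  also have "\<dots> = l' + (L - l') * (norm (p w))\<^sup>2" by (simp add: algebra_simps)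
  also have "\<dots> \<le> l' + (L - l') * s" using pw L by (intro add_left_mono mult_left_mono) auto
  also have "\<dots> \<le> l * (1 - s)" using gap by (simp add: algebra_simps)
  also have "\<dots> \<le> l * (norm (p (z i)))\<^sup>2" using pz l by (rule mult_left_mono)
  also have "\<dots> \<le> z i \<bullet> f (z i)" by (rule lower)
  finally show "(cos (t * \<sigma> i) *\<^sub>R u i - sin (t * \<sigma> i) *\<^sub>R x i) \<bullet>
      f (cos (t * \<sigma> i) *\<^sub>R u i - sin (t * \<sigma> i) *\<^sub>R x i) \<le> geod x u \<sigma> t i \<bullet> f (geod x u \<sigma> t i)"
    by (simp add: w_def z_def)
qed auto

section \<open>Frames, singular values and principal angles\<close>

lemma frame_iff_orthonormal: "frame X \<longleftrightarrow> orthonormal (\<lambda>i. column i X)"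
  by (simp add: frame_def matrix_mult_transpose_dot_column orthonormal_def mat_def vec_eq_iff)

lemma columns_eq_range: "columns X = range (\<lambda>i. column i X)"
  by (auto simp: columns_def)

lemma orthonormal_family_frame:
  fixes x :: "'k::finite \<Rightarrow> real^'n"
  assumes "orthonormal x"
  obtains X :: "real^'k^'n" where "frame X" "\<And>i. column i X = x i" "columns X = range x"
proof -
  define X :: "real^'k^'n" where "X = (\<chi> i j. x j $ i)"
  have col: "column i X = x i" for i by (simp add: X_def column_def vec_eq_iff)
  show thesis
    using assms by (intro that[of X]) (simp_all add: frame_iff_orthonormal columns_eq_range col)
qed

lemma matrix_mult_transpose_entry: "(transpose X ** Y) $ i $ j = column i X \<bullet> column j (Y :: real^'k^'n)"
  by (simp add: matrix_matrix_mult_def transpose_def column_def inner_vec_def)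

lemma column_mult_diag_mat: "column i (M ** diag_mat d) = d $ i *\<^sub>R column i M"
  by (simp add: vec_eq_iff column_def matrix_matrix_mult_def diag_mat_def if_distrib sum.delta
      mult.commute cong: if_cong)

lemma column_add: "column i (P + Q) = column i P + column i Q"
  by (simp add: column_def vec_eq_iff)

lemma columns_geodesic:
  "column i (M ** diag_mat (\<chi> i. cos (t * \<sigma> $ i)) + U ** diag_mat (\<chi> i. sin (t * \<sigma> $ i))) =
    geod (\<lambda>i. column i M) (\<lambda>i. column i U) (($) \<sigma>) t i"
  by (simp add: column_add column_mult_diag_mat geod_def)

text \<open>
  The factor \<open>V\<close> of the SVD can be absorbed into the representative of the starting point, since
  \<open>X ** V\<close> is a frame of the same subspace.
\<close>

lemma geodesic_segment_iff:
  fixes c :: "real \<Rightarrow> (real^'n) set"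
  shows "geodesic_segment TYPE('k::finite) c \<longleftrightarrow>
    (\<exists>(x :: 'k \<Rightarrow> real^'n) u \<sigma>. horizontal x u \<sigma> \<and> (\<forall>i. 0 \<le> \<sigma> i) \<and>
      (\<forall>t\<in>{0..1}. c t = span (range (geod x u \<sigma> t))))"
proof
  assume "geodesic_segment TYPE('k) c"
  then obtain X U :: "real^'k^'n" and G and \<sigma> :: "real^'k" and V where
    X: "frame X" and G: "transpose X ** G = 0" and svd: "compact_svd G U \<sigma> V"
    and c: "\<And>t. t \<in> {0..1} \<Longrightarrow> c t = span (columns (X ** V ** diag_mat (\<chi> i. cos (t * \<sigma> $ i)) +
        U ** diag_mat (\<chi> i. sin (t * \<sigma> $ i))))"
    unfolding geodesic_segment_def by blast
  have U: "frame U" and V: "orthogonal_matrix V" and \<sigma>: "\<And>i. 0 \<le> \<sigma> $ i"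
    and Geq: "G = U ** diag_mat \<sigma> ** transpose V"
    using svd by (auto simp: compact_svd_def)
  have "transpose (X ** V) ** (X ** V) = transpose V ** (transpose X ** X) ** V"
    by (simp add: matrix_transpose_mul matrix_mul_assoc)
  then have XV: "frame (X ** V)"
    using X V by (simp add: frame_def orthogonal_matrix)
  have "transpose (X ** V) ** (U ** diag_mat \<sigma>) =
      transpose (X ** V) ** (U ** diag_mat \<sigma> ** (transpose V ** V))"
    using V by (simp add: orthogonal_matrix)
  also have "\<dots> = transpose V ** (transpose X ** G) ** V"
    by (simp add: Geq matrix_transpose_mul matrix_mul_assoc)
  also have "\<dots> = 0" by (simp add: G)
  finally have "column i (X ** V) \<bullet> column j (U ** diag_mat \<sigma>) = 0" for i j
    unfolding matrix_mult_transpose_entry[symmetric] by simp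
  then have "column i (X ** V) \<bullet> column j U = 0" if "\<sigma> $ j \<noteq> 0" for i j
    using that by (auto simp: column_mult_diag_mat)
  then have "horizontal (\<lambda>i. column i (X ** V)) (\<lambda>i. column i U) (($) \<sigma>)"
    using XV U by (simp add: horizontal_def frame_iff_orthonormal)
  then show "\<exists>(x :: 'k \<Rightarrow> real^'n) u \<sigma>. horizontal x u \<sigma> \<and> (\<forall>i. 0 \<le> \<sigma> i) \<and>
      (\<forall>t\<in>{0..1}. c t = span (range (geod x u \<sigma> t)))"
    using \<sigma> c unfolding columns_eq_range columns_geodesic by blast
next
  assume "\<exists>(x :: 'k \<Rightarrow> real^'n) u \<sigma>. horizontal x u \<sigma> \<and> (\<forall>i. 0 \<le> \<sigma> i) \<and>
      (\<forall>t\<in>{0..1}. c t = span (range (geod x u \<sigma> t)))"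
  then obtain x u :: "'k \<Rightarrow> real^'n" and \<sigma> where h: "horizontal x u \<sigma>" and \<sigma>: "\<And>i. 0 \<le> \<sigma> i"
    and c: "\<And>t. t \<in> {0..1} \<Longrightarrow> c t = span (range (geod x u \<sigma> t))"
    by blast
  have "orthonormal x" "orthonormal u" using h by (simp_all add: horizontal_def)
  then obtain X U :: "real^'k^'n" where X: "frame X" "\<And>i. column i X = x i"
    and U: "frame U" "\<And>i. column i U = u i"
    using orthonormal_family_frame by metis
  define S where "S = (\<chi> i. \<sigma> i)"
  define G where "G = U ** diag_mat S"
  have "transpose X ** G = 0"
    using h by (auto simp: vec_eq_iff matrix_mult_transpose_entry G_def column_mult_diag_mat S_def
        X U horizontal_def)
  moreover have "compact_svd G U S (mat 1)"
    using U(1) \<sigma> by (simp add: compact_svd_def G_def S_def orthogonal_matrix)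
  moreover have "c t = span (columns (X ** mat 1 ** diag_mat (\<chi> i. cos (t * S $ i)) +
        U ** diag_mat (\<chi> i. sin (t * S $ i))))" if "t \<in> {0..1}" for t
  proof -
    have "geod (\<lambda>i. column i (X ** mat 1)) (\<lambda>i. column i U) (($) S) t = geod x u \<sigma> t"
      by (simp add: fun_eq_iff geod_def X U S_def)
    then show ?thesis unfolding columns_eq_range columns_geodesic by (simp add: c[OF that])
  qed
  ultimately show "geodesic_segment TYPE('k) c"
    unfolding geodesic_segment_def using X(1) by blast
qed

lemma objective_span_range:
  fixes x :: "'k::finite \<Rightarrow> real^'n"
  assumes "orthonormal x"
  shows "objective TYPE('k) A (span (range x)) = - (\<Sum>i\<in>UNIV. x i \<bullet> (A *v x i))"
proof -
  obtain X :: "real^'k^'n" where X: "frame X" "\<And>i. column i X = x i" "columns X = range x"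
    using orthonormal_family_frame[OF assms] by blast
  have "column i (A ** X) = A *v x i" for i
    by (simp add: column_def vec_eq_iff matrix_matrix_mult_def matrix_vector_mult_def flip: X(2))
  then have "trace (transpose X ** A ** X) = (\<Sum>i\<in>UNIV. x i \<bullet> (A *v x i))"
    by (simp add: trace_def matrix_mult_transpose_entry X(2) flip: matrix_mul_assoc)
  then show ?thesis using objective_span_columns[OF X(1)] by (simp add: X(3))
qed

text \<open>
  \<open>Min\<close> is meaningful because there are only finitely many singular values: eigenvectors of
  \<open>transpose M ** M\<close> for distinct ones are orthogonal. The least one comes from the least eigenvalue.
\<close>

lemma Min_singular_values:
  fixes M :: "real^'k^'k"
  shows "0 \<le> Min (singular_values M)"
    and "\<exists>a. norm a = 1 \<and> norm (M *v a) = Min (singular_values M)"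
    and "Min (singular_values M) * norm a \<le> norm (M *v a)"
proof -
  define N where "N = transpose M ** M"
  have form: "y \<bullet> (N *v w) = (M *v y) \<bullet> (M *v w)" for y w
    by (simp add: N_def dot_lmul_matrix flip: matrix_vector_mul_assoc)
       (metis dot_lmul_matrix vector_transpose_matrix transpose_transpose)
  have sym: "(N *v y) \<bullet> w = y \<bullet> (N *v w)" for y w
    using form[of w y] form[of y w] by (simp add: inner_commute)
  obtain e m where e: "norm e = 1" "N *v e = m *\<^sub>R e"
    and least: "\<And>y. m * (norm y)\<^sup>2 \<le> y \<bullet> (N *v y)"
    using least_eigenvector[of "(*v) N" UNIV] sym
    by (metis UNIV_I UNIV_not_singleton matrix_vector_mul_linear subset_UNIV subspace_UNIV)
  have m: "m = (norm (M *v e))\<^sup>2"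
    using form[of e e] e by (simp add: power2_norm_eq_inner norm_eq_1)
  define \<sigma> where "\<sigma> = norm (M *v e)"
  have le: "\<sigma> * norm y \<le> norm (M *v y)" for y
  proof -
    have "(\<sigma> * norm y)\<^sup>2 \<le> (norm (M *v y))\<^sup>2"
      using least[of y] form[of y y] by (simp add: m \<sigma>_def power_mult_distrib power2_norm_eq_inner)
    then show ?thesis by (rule power2_le_imp_le) simp
  qed
  have mem: "\<sigma> \<in> singular_values M"
    unfolding singular_values_def N_def[symmetric]
    using e by (auto simp: \<sigma>_def m intro!: exI[of _ e])
  have lower: "\<sigma> \<le> \<tau>" if \<tau>: "\<tau> \<in> singular_values M" for \<tau>
  proof -
    obtain y where y: "y \<noteq> 0" "N *v y = \<tau>\<^sup>2 *\<^sub>R y" and "0 \<le> \<tau>"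
      using \<tau> by (auto simp: singular_values_def N_def)
    have "(norm (M *v y))\<^sup>2 = (\<tau> * norm y)\<^sup>2"
      using form[of y y] y(2) by (simp add: power2_norm_eq_inner power_mult_distrib)
    then have "norm (M *v y) = \<tau> * norm y"
      using \<open>0 \<le> \<tau>\<close> by (simp add: power2_eq_iff_nonneg)
    then show ?thesis using le[of y] y(1) by simp
  qed
  have "finite (singular_values M)"
  proof -
    have "\<forall>\<tau>\<in>singular_values M. \<exists>y. y \<noteq> 0 \<and> N *v y = \<tau>\<^sup>2 *\<^sub>R y"
      by (auto simp: singular_values_def N_def)
    then obtain y where y: "\<And>\<tau>. \<tau> \<in> singular_values M \<Longrightarrow> y \<tau> \<noteq> 0 \<and> N *v y \<tau> = \<tau>\<^sup>2 *\<^sub>R y \<tau>"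
      by metis
    have orth: "y \<tau> \<bullet> y \<rho> = 0" if \<tau>: "\<tau> \<in> singular_values M" and \<rho>: "\<rho> \<in> singular_values M" and "\<tau> \<noteq> \<rho>" for \<tau> \<rho>
    proof -
      have "\<tau>\<^sup>2 * (y \<tau> \<bullet> y \<rho>) = \<rho>\<^sup>2 * (y \<tau> \<bullet> y \<rho>)"
        using sym[of "y \<tau>" "y \<rho>"] y[OF \<tau>] y[OF \<rho>] by simp
      moreover have "\<tau>\<^sup>2 \<noteq> \<rho>\<^sup>2"
        using \<tau> \<rho> \<open>\<tau> \<noteq> \<rho>\<close> by (auto simp: singular_values_def power2_eq_iff_nonneg)
      ultimately show ?thesis by simp
    qed
    have "inj_on y (singular_values M)"
      using orth y by (metis inj_onI inner_eq_zero_iff)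
    moreover have "independent (y ` singular_values M)"
    proof (rule pairwise_orthogonal_independent)
      show "pairwise orthogonal (y ` singular_values M)"
        unfolding pairwise_def orthogonal_def using orth by blast
      show "0 \<notin> y ` singular_values M" using y by force
    qed
    ultimately show ?thesis using independent_imp_finite finite_imageD by blast
  qed
  then have Min: "Min (singular_values M) = \<sigma>" using mem lower by (intro Min_eqI) auto
  show "0 \<le> Min (singular_values M)" by (simp add: Min \<sigma>_def)
  show "\<exists>a. norm a = 1 \<and> norm (M *v a) = Min (singular_values M)"
    using e(1) by (auto simp: Min \<sigma>_def)
  show "Min (singular_values M) * norm a \<le> norm (M *v a)" by (simp add: Min le)
qed

lemma norm_sum_orthonormal:
  fixes x :: "'k::finite \<Rightarrow> 'a::real_inner" and a :: "real^'k"
  assumes "orthonormal x"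
  shows "norm (\<Sum>i\<in>UNIV. a $ i *\<^sub>R x i) = norm a"
  unfolding norm_eq_sqrt_inner inner_orthonormal_sums[OF assms] inner_vec_def by simp

text \<open>
  In the coordinates given by \<open>x\<close> and \<open>w\<close>, the matrix whose singular values define the angle is the
  restriction of \<open>proj w\<close> to the span of \<open>x\<close>. Its least singular value is the smallest ratio
  of the lengths of \<open>proj w y\<close> and \<open>y\<close>.
\<close>

lemma largest_principal_angle_le_iff_tilt_le:
  fixes x w :: "'k::finite \<Rightarrow> real^'n"
  assumes x: "orthonormal x" and w: "orthonormal w"
  shows "(sin (largest_principal_angle TYPE('k) (span (range x)) (span (range w))))\<^sup>2 \<le> s \<longleftrightarrow>
    tilt_le (proj w) s (span (range x))"
proof -
  obtain X :: "real^'k^'n" where X: "frame X" "\<And>i. column i X = x i" "columns X = range x"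
    using orthonormal_family_frame[OF x] by blast
  obtain W :: "real^'k^'n" where W: "frame W" "\<And>i. column i W = w i" "columns W = range w"
    using orthonormal_family_frame[OF w] by blast
  define M where "M = transpose W ** X"
  define \<mu> where "\<mu> = Min (singular_values M)"
  define y where "y a = (\<Sum>i\<in>UNIV. a $ i *\<^sub>R x i)" for a :: "real^'k"
  have ny: "norm (y a) = norm a" for a
    unfolding y_def by (rule norm_sum_orthonormal[OF x])
  have span: "span (range x) = range y"
  proof -
    have "(\<Sum>i\<in>UNIV. a i *\<^sub>R x i) = y (\<chi> i. a i)" for a by (simp add: y_def)
    then have "(\<Sum>i\<in>UNIV. a i *\<^sub>R x i) \<in> range y" for a by blast
    then show ?thesis by (auto simp: span_range_finite_eq) (auto simp: y_def)
  qed
  have nM: "norm (M *v a) = norm (proj w (y a))" for a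
  proof -
    have "(M *v a) $ i = w i \<bullet> y a" for i
      by (simp add: M_def matrix_vector_mult_def matrix_mult_transpose_entry X(2) W(2) y_def
          inner_sum_right mult.commute)
    then have "proj w (y a) = (\<Sum>i\<in>UNIV. (M *v a) $ i *\<^sub>R w i)" by (simp add: proj_def)
    then show ?thesis by (simp add: norm_sum_orthonormal[OF w])
  qed
  have pyth: "(norm (y a - proj w (y a)))\<^sup>2 = (norm a)\<^sup>2 - (norm (M *v a))\<^sup>2" for a
    using norm_projector_Pythagoras[OF projector_proj[OF w], of "y a"] by (simp add: ny nM)
  obtain e where e: "norm e = 1" "norm (M *v e) = \<mu>"
    using Min_singular_values(2)[of M] by (auto simp: \<mu>_def)
  have \<mu>0: "0 \<le> \<mu>" and \<mu>: "\<mu> * norm a \<le> norm (M *v a)" for a :: "real^'k"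
    using Min_singular_values(1,3)[of M] by (simp_all add: \<mu>_def)
  have "\<mu>\<^sup>2 \<le> 1" using pyth[of e] e by (metis diff_ge_0_iff_ge one_power2 zero_le_power2)
  then have \<mu>1: "\<mu> \<le> 1" using \<mu>0 by (simp add: power2_le_iff_abs_le abs_square_le_1)
  have "largest_principal_angle TYPE('k) (span (range x)) (span (range w)) = arccos \<mu>"
    using largest_principal_angle_span_columns[OF X(1) W(1)] by (simp add: X(3) W(3) M_def \<mu>_def)
  then have "(sin (largest_principal_angle TYPE('k) (span (range x)) (span (range w))))\<^sup>2 = 1 - \<mu>\<^sup>2"
    using \<mu>0 \<mu>1 by (simp add: sin_squared_eq)
  moreover have "1 - \<mu>\<^sup>2 \<le> s \<longleftrightarrow> (\<forall>a. (norm a)\<^sup>2 - (norm (M *v a))\<^sup>2 \<le> s * (norm a)\<^sup>2)"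
  proof
    assume le: "1 - \<mu>\<^sup>2 \<le> s"
    show "\<forall>a. (norm a)\<^sup>2 - (norm (M *v a))\<^sup>2 \<le> s * (norm a)\<^sup>2"
    proof
      fix a :: "real^'k"
      have "(1 - s) * (norm a)\<^sup>2 \<le> \<mu>\<^sup>2 * (norm a)\<^sup>2" using le by (intro mult_right_mono) auto
      also have "\<dots> \<le> (norm (M *v a))\<^sup>2"
        using \<mu>0 \<mu>[of a] by (simp add: power_mono flip: power_mult_distrib)
      finally show "(norm a)\<^sup>2 - (norm (M *v a))\<^sup>2 \<le> s * (norm a)\<^sup>2" by (simp add: algebra_simps)
    qed
  next
    assume "\<forall>a. (norm a)\<^sup>2 - (norm (M *v a))\<^sup>2 \<le> s * (norm a)\<^sup>2"
    from spec[OF this, of e] show "1 - \<mu>\<^sup>2 \<le> s" using e by simp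
  qed
  ultimately show ?thesis by (simp add: tilt_le_def span pyth ny)
qed

section \<open>Eigenvalue bounds\<close>

text \<open>
  In the coordinates of the eigenbasis the form is a sum of squares weighted by the eigenvalues, and the projector
  keeps the first \<open>k\<close> coordinates. The bijection \<open>h\<close> lets the type \<open>'k\<close> index these coordinates.
\<close>

lemma eigenbasis_form_bounds:
  fixes A :: "real^'n^'n" and v :: "nat \<Rightarrow> real^'n" and w :: "'k::finite \<Rightarrow> real^'n"
  assumes n: "n = CARD('n)" and k: "1 \<le> k" "k < n"
    and psd: "\<forall>x. 0 \<le> x \<bullet> (A *v x)"
    and decr: "\<forall>i\<in>{1..n}. \<forall>j\<in>{1..n}. i \<le> j \<longrightarrow> lam j \<le> lam i"
    and on: "\<forall>i\<in>{1..n}. \<forall>j\<in>{1..n}. v i \<bullet> v j = (if i = j then 1 else 0)"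
    and eigen: "\<forall>i\<in>{1..n}. A *v v i = lam i *\<^sub>R v i"
    and h: "bij_betw h (UNIV :: 'k set) {1..k}"
  shows "\<forall>i\<in>{1..n}. 0 \<le> lam i"
    and "lam k * (norm (proj (v \<circ> h) y))\<^sup>2 \<le> y \<bullet> (A *v y)"
    and "y \<bullet> (A *v y) \<le> lam 1 * (norm (proj (v \<circ> h) y))\<^sup>2 +
      lam (k + 1) * (norm (y - proj (v \<circ> h) y))\<^sup>2"
proof -
  show lam0: "\<forall>i\<in>{1..n}. 0 \<le> lam i"
  proof
    fix i assume i: "i \<in> {1..n}"
    have "v i \<bullet> (A *v v i) = lam i" using eigen on i by simp
    then show "0 \<le> lam i" using psd by metis
  qed
  define a where "a i = v i \<bullet> y" for i
  have ya: "y \<bullet> v i = a i" for i by (simp add: a_def inner_commute)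
  have hk: "h i \<in> {1..n}" for i
  proof -
    have "h i \<in> {1..k}" using bij_betwE[OF h] by blast
    then show ?thesis using k by simp
  qed
  have onw: "orthonormal (v \<circ> h)"
    using on hk h by (auto simp: orthonormal_def bij_betw_def inj_on_def)
  have "card (UNIV :: 'n set) = card {1..n}" by (simp add: n)
  then obtain g :: "'n \<Rightarrow> nat" where g: "bij_betw g UNIV {1..n}"
    using finite_same_card_bij[OF finite finite_atLeastAtMost] by blast
  have gn: "g i \<in> {1..n}" for i using g by (auto simp: bij_betw_def)
  have ong: "orthonormal (v \<circ> g)"
    using on gn g by (auto simp: orthonormal_def bij_betw_def inj_on_def)
  have "span (range (v \<circ> g)) = UNIV"
    using dim_span_orthonormal[OF ong] by (intro subspace_dim_equal) (auto simp del: dim_span)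
  then have "proj (v \<circ> g) y = y"
    using projector_range_iff[OF projector_proj[OF ong], of y] range_proj[OF ong] by simp
  then have "y = (\<Sum>i\<in>UNIV. a (g i) *\<^sub>R v (g i))" by (simp add: proj_def a_def)
  also have "\<dots> = (\<Sum>i\<in>{1..n}. a i *\<^sub>R v i)" using g by (rule sum.reindex_bij_betw)
  finally have y: "y = (\<Sum>i\<in>{1..n}. a i *\<^sub>R v i)" .
  have "A *v y = (\<Sum>i\<in>{1..n}. a i *\<^sub>R (A *v v i))"
    unfolding y linear_sum[OF matrix_vector_mul_linear] linear_scale[OF matrix_vector_mul_linear] ..
  also have "\<dots> = (\<Sum>i\<in>{1..n}. (lam i * a i) *\<^sub>R v i)"
    using eigen by (intro sum.cong) (auto simp: mult.commute)
  finally have Ay: "y \<bullet> (A *v y) = (\<Sum>i\<in>{1..n}. lam i * (a i)\<^sup>2)"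
    by (simp add: inner_sum_right ya power2_eq_square mult.assoc)
  have "y \<bullet> y = (\<Sum>i\<in>{1..n}. a i * (y \<bullet> v i))"
    by (subst (2) y) (simp add: inner_sum_right)
  then have ny: "(norm y)\<^sup>2 = (\<Sum>i\<in>{1..n}. (a i)\<^sup>2)"
    unfolding power2_norm_eq_inner by (simp add: ya power2_eq_square)
  have "(norm (proj (v \<circ> h) y))\<^sup>2 = (\<Sum>i\<in>UNIV. (a (h i))\<^sup>2)"
    unfolding power2_norm_eq_inner proj_def inner_orthonormal_sums[OF onw]
    by (simp add: a_def power2_eq_square)
  also have "\<dots> = (\<Sum>i\<in>{1..k}. (a i)\<^sup>2)" using h by (rule sum.reindex_bij_betw)
  finally have npy: "(norm (proj (v \<circ> h) y))\<^sup>2 = (\<Sum>i\<in>{1..k}. (a i)\<^sup>2)" .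
  have split: "{1..n} = {1..k} \<union> {k+1..n}" "{1..k} \<inter> {k+1..n} = {}" using k by auto
  have sum_split: "(\<Sum>i\<in>{1..n}. F i) = (\<Sum>i\<in>{1..k}. F i) + (\<Sum>i\<in>{k+1..n}. F i)" for F :: "nat \<Rightarrow> real"
    unfolding split(1) by (rule sum.union_disjoint) auto
  have nqy: "(norm (y - proj (v \<circ> h) y))\<^sup>2 = (\<Sum>i\<in>{k+1..n}. (a i)\<^sup>2)"
    using norm_projector_Pythagoras[OF projector_proj[OF onw], of y] npy ny
      sum_split[of "\<lambda>i. (a i)\<^sup>2"] by simp
  have "lam k * (\<Sum>i\<in>{1..k}. (a i)\<^sup>2) \<le> (\<Sum>i\<in>{1..k}. lam i * (a i)\<^sup>2)"
    unfolding sum_distrib_left using decr k by (intro sum_mono mult_right_mono) auto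
  moreover have "0 \<le> (\<Sum>i\<in>{k+1..n}. lam i * (a i)\<^sup>2)"
    using lam0 by (intro sum_nonneg mult_nonneg_nonneg) auto
  ultimately show "lam k * (norm (proj (v \<circ> h) y))\<^sup>2 \<le> y \<bullet> (A *v y)"
    unfolding Ay npy sum_split by simp
  have "(\<Sum>i\<in>{1..k}. lam i * (a i)\<^sup>2) \<le> lam 1 * (\<Sum>i\<in>{1..k}. (a i)\<^sup>2)"
    unfolding sum_distrib_left using decr k by (intro sum_mono mult_right_mono) auto
  moreover have "(\<Sum>i\<in>{k+1..n}. lam i * (a i)\<^sup>2) \<le> lam (k + 1) * (\<Sum>i\<in>{k+1..n}. (a i)\<^sup>2)"
    unfolding sum_distrib_left using decr k by (intro sum_mono mult_right_mono) auto
  ultimately show "y \<bullet> (A *v y) \<le> lam 1 * (norm (proj (v \<circ> h) y))\<^sup>2 +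
      lam (k + 1) * (norm (y - proj (v \<circ> h) y))\<^sup>2"
    unfolding Ay npy nqy sum_split by simp
qed

section \<open>Geodesic convexity of the objective\<close>

theorem theorem19:
  fixes A :: "real^'n^'n"
    and lam :: "nat \<Rightarrow> real"
    and v :: "nat \<Rightarrow> real^'n"
    and n k :: nat
    and \<delta> :: real
  assumes n: "n = CARD('n)"
    and k: "k = CARD('k::finite)"
    and k_le: "real k \<le> real n / 2"
    and sym: "transpose A = A"
    and psd: "\<forall>x. 0 \<le> x \<bullet> (A *v x)"
    and decr: "\<forall>i\<in>{1..n}. \<forall>j\<in>{1..n}. i \<le> j \<longrightarrow> lam j \<le> lam i"
    and orthonormal: "\<forall>i\<in>{1..n}. \<forall>j\<in>{1..n}. v i \<bullet> v j = (if i = j then 1 else 0)"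
    and eigen: "\<forall>i\<in>{1..n}. A *v v i = lam i *\<^sub>R v i"
    and gap: "\<delta> = lam k - lam (k + 1)"
    and gap_pos: "0 < \<delta>"
  shows "geodesically_convex_on TYPE('k)
           {S \<in> grassmannian TYPE('k).
              (sin (largest_principal_angle TYPE('k) S (span (v ` {1..k}))))\<^sup>2
                \<le> \<delta> / (lam 1 + lam k)}
           (objective TYPE('k) A)"
proof -
  define s where "s = \<delta> / (lam 1 + lam k)"
  have k1: "1 \<le> k" by (simp add: k Suc_le_eq)
  have kn: "k < n" using k_le k1 by linarith
  have "card (UNIV :: 'k set) = card {1..k}" by (simp add: k)
  then obtain h :: "'k \<Rightarrow> nat" where h: "bij_betw h UNIV {1..k}"
    using finite_same_card_bij[OF finite finite_atLeastAtMost] by blast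
  define w where "w = v \<circ> h"
  define p where "p = proj w"
  note bounds = eigenbasis_form_bounds[OF n k1 kn psd decr orthonormal eigen h,
      folded w_def, folded p_def]
  have h_range: "h i \<in> {1..n}" for i
  proof -
    have "h i \<in> {1..k}" using bij_betwE[OF h] by blast
    then show ?thesis using kn by simp
  qed
  have w: "orthonormal w"
    using orthonormal h_range h by (auto simp: orthonormal_def w_def bij_betw_def inj_on_def)
  have "range w = v ` {1..k}"
    unfolding w_def image_comp[symmetric] using h by (simp add: bij_betw_def)
  then have V: "span (v ` {1..k}) = span (range w)" by simp
  have p: "projector p" and dim_p: "dim (range p) = CARD('k)"
    by (simp_all add: p_def projector_proj w range_proj dim_span_orthonormal del: dim_span)
  have lam: "0 \<le> lam (k + 1)" "lam k \<le> lam 1" "lam (k + 1) \<le> lam 1"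
    using bounds(1) decr k1 kn by auto
  have lam_k: "0 < lam k" using gap gap_pos lam by simp
  have pos: "0 < lam 1 + lam k" using lam_k lam by simp
  have s_eq: "s * (lam 1 + lam k) = \<delta>" using pos by (simp add: s_def)
  \<comment> \<open>The largest angle in the ball is at most \<open>pi / 4\<close>, because \<open>0 \<le> lam (k + 1)\<close> and \<open>lam k \<le> lam 1\<close>.\<close>
  have s: "0 \<le> s" "s \<le> 1/2"
    using gap gap_pos lam pos by (simp_all add: s_def divide_simps)
  have s1: "s < 1" using s by simp
  \<comment> \<open>The radius of the ball is chosen for this estimate, whose slack is \<open>s * lam (k + 1)\<close>.\<close>
  have rate: "lam 1 * s + lam (k + 1) * (1 - s) \<le> lam k * (1 - s)"
  proof -
    have "lam k * (1 - s) - (lam 1 * s + lam (k + 1) * (1 - s)) =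
        \<delta> - s * (lam 1 + lam k) + s * lam (k + 1)"
      by (simp add: gap algebra_simps)
    also have "\<dots> \<ge> 0" unfolding s_eq using s lam by simp
    finally show ?thesis by simp
  qed
  define B where "B = {S \<in> grassmannian TYPE('k).
      (sin (largest_principal_angle TYPE('k) S (span (v ` {1..k}))))\<^sup>2 \<le> \<delta> / (lam 1 + lam k)}"
  have grass: "S \<in> grassmannian TYPE('k) \<longleftrightarrow>
      (\<exists>x :: 'k \<Rightarrow> real^'n. orthonormal x \<and> S = span (range x))" for S
  proof
    assume "S \<in> grassmannian TYPE('k)"
    then show "\<exists>x :: 'k \<Rightarrow> real^'n. orthonormal x \<and> S = span (range x)"
      unfolding grassmannian_eq_frames frame_iff_orthonormal columns_eq_range by blast
  next
    assume "\<exists>x :: 'k \<Rightarrow> real^'n. orthonormal x \<and> S = span (range x)"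
    then show "S \<in> grassmannian TYPE('k)"
      using dim_span_orthonormal unfolding grassmannian_def by blast
  qed
  have inB: "span (range x) \<in> B \<longleftrightarrow> tilt_le p s (span (range x))"
    if "orthonormal x" for x :: "'k \<Rightarrow> real^'n"
  proof -
    have "span (range x) \<in> grassmannian TYPE('k)" using grass that by blast
    then show ?thesis
      unfolding B_def V s_def[symmetric] p_def mem_Collect_eq
      using largest_principal_angle_le_iff_tilt_le[OF that w, of s] by blast
  qed
  have "geodesically_convex TYPE('k) B"
    unfolding geodesically_convex_def
  proof (intro conjI ballI)
    show "B \<subseteq> grassmannian TYPE('k)" by (auto simp: B_def)
    fix P Q assume "P \<in> B" "Q \<in> B"
    then obtain y z :: "'k \<Rightarrow> real^'n" where y: "orthonormal y" "P = span (range y)"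
      and z: "orthonormal z" "Q = span (range z)"
      using grass by (auto simp: B_def)
    have tilt: "tilt_le p s P" "tilt_le p s Q"
      using inB y z \<open>P \<in> B\<close> \<open>Q \<in> B\<close> by auto
    have ry: "range (proj y) = P" and rz: "range (proj z) = Q"
      using y z by (simp_all add: range_proj)
    have dims: "dim P = CARD('k)" "dim Q = CARD('k)"
      unfolding y(2) z(2) using y(1) z(1) dim_span_orthonormal by blast+
    obtain x u :: "'k \<Rightarrow> real^'n" and \<sigma> where hor: "horizontal x u \<sigma>"
      and ends: "span (range (geod x u \<sigma> 0)) = P" "span (range (geod x u \<sigma> 1)) = Q"
      and \<sigma>: "\<And>i. 0 \<le> \<sigma> i" "\<And>i. \<sigma> i \<le> pi / 2"
      and mid: "\<And>i. \<sigma> i = pi / 2 \<Longrightarrow> p (geod x u \<sigma> (1/2) i) = geod x u \<sigma> (1/2) i"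
      using connecting_geodesic[OF p projector_proj[OF y(1)] projector_proj[OF z(1)] dim_p _ _ s,
          unfolded ry rz, OF dims tilt] by metis
    define c where "c t = span (range (geod x u \<sigma> t))" for t
    have "geodesic_segment TYPE('k) c"
      unfolding geodesic_segment_iff c_def using hor \<sigma>(1) by blast
    moreover have "c t \<in> B" if "t \<in> {0..1}" for t
      using tilt_le_geodesic_segment[OF hor p dim_p s \<sigma> _ _ mid that] ends tilt
        inB[OF orthonormal_geod[OF hor]] by (simp add: c_def)
    ultimately show "\<exists>c. geodesic_segment TYPE('k) c \<and> c 0 = P \<and> c 1 = Q \<and> c ` {0..1} \<subseteq> B"
      using ends by (intro exI[of _ c]) (auto simp: c_def)
  qed
  moreover have "convex_on {0..1} (objective TYPE('k) A \<circ> c)"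
    if seg: "geodesic_segment TYPE('k) c" and c: "c ` {0..1} \<subseteq> B" for c
  proof -
    obtain x u :: "'k \<Rightarrow> real^'n" and \<sigma> where hor: "horizontal x u \<sigma>"
      and ct: "\<And>t. t \<in> {0..1} \<Longrightarrow> c t = span (range (geod x u \<sigma> t))"
      using seg unfolding geodesic_segment_iff by blast
    have on: "orthonormal (geod x u \<sigma> t)" for t using hor by (rule orthonormal_geod)
    have "tilt_le p s (span (range (geod x u \<sigma> t)))" if "t \<in> {0..1}" for t
      using c ct[OF that] that inB[OF on] by (metis image_subset_iff)
    then have "convex_on {0..1}
        (\<lambda>t. - (\<Sum>i\<in>UNIV. geod x u \<sigma> t i \<bullet> (A *v geod x u \<sigma> t i)))"
      using convex_on_geod_trace[OF _ hor p dim_p s(1) s1 bounds(2) _ bounds(3) lam(3) rate] lam_k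
      by simp
    moreover have "(objective TYPE('k) A \<circ> c) t =
        - (\<Sum>i\<in>UNIV. geod x u \<sigma> t i \<bullet> (A *v geod x u \<sigma> t i))" if "t \<in> {0..1}" for t
      using ct[OF that] by (simp add: objective_span_range[OF on])
    ultimately show ?thesis by (rule convex_on_eq)
  qed
  ultimately show ?thesis
    unfolding B_def[symmetric] geodesically_convex_on_def by blast
qed

end
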